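(* Let $s>0$ and let $(S(t))_{t\ge 0}$ be the semigroup of the discrete generalized KMP process with parameter $2s$ on $\mathbb{N}^V$. For $\theta=(\theta_i)_{i\in V}\in(0,\infty)^V$ let $\bigotimes_{i\in V}\nu_{\theta_i}$ be the product of discrete Gamma distributions with parameters $\theta_i$, and let $\big(\bigotimes_{i\in V}\nu_{\theta_i}\big)S(t)$ be the distribution at time $t$ of the process started from $\bigotimes_{i\in V}\nu_{\theta_i}$. Then for all $t>0$ $$\Big(\bigotimes_{i\in V}\nu_{\theta_i}\Big)S(t)=\mathbb{E}_\theta\Big(\bigotimes_{i\in V}\nu_{\theta_i(t)}\Big),$$ where $\mathbb{E}_\theta$ denotes expectation in the hidden parameter model $(\theta(t))_{t\ge0}$ started from $\theta(0)=\theta$. As a consequence, the set of mixtures $\int\big(\bigotimes_{i\in V}\nu_{\theta_i}\big)\,\Xi[d\theta]$ ($\Xi$ a probability measure on the parameters $\theta$) is closed under the evolution of the discrete generalized KMP process.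
   Context: $\mathbb{N}=\{0,1,2,\dots\}$. $V$ is a finite set, $p(i,j)=p(j,i)\ge 0$ ($i,j\in V$) are symmetric edge weights which are irreducible: any two vertices are joined by a finite path along which $p>0$. Sums $\sum_{i,j}$ run over ordered pairs of distinct vertices. $\mathrm{Beta}(2s,2s)[du]=\frac{1}{B(2s,2s)}u^{2s-1}(1-u)^{2s-1}du$ on $[0,1]$. Discrete generalized KMP process: the Markov process on $\mathbb{N}^V$ with generator $Lf(\eta)=\sum_{i,j\in V}p(i,j)L_{ij}f(\eta)$, where $L_{ij}$ acts on the variables $(\eta_i,\eta_j)=(x,y)$ as $L_{ij}f(x,y)=\mathbb{E}\big(f(X,x+y-X)-f(x,y)\big)$ with $X$ beta-binomial: $\mathbb{P}(X=k)=\int_0^1\binom{x+y}{k}u^k(1-u)^{x+y-k}\,\mathrm{Beta}(2s,2s)[du]$, $k\in\{0,\dots,x+y\}$. Discrete Gamma distribution, $\theta>0$: $\nu_\theta(n)=\frac{1}{n!}\left(\frac{\theta}{1+\theta}\right)^n\frac{\Gamma(2s+n)}{\Gamma(2s)}\left(\frac{1}{1+\theta}\right)^{2s}$, $n\in\mathbb{N}$. Hidden parameter model: the Markov process on $[0,\infty)^V$ with generator $\mathcal{L}f(\theta)=\sum_{i,j\in V}p(i,j)\mathcal{L}_{ij}f(\theta)$, where $\mathcal{L}_{ij}$ acts on $(\theta_i,\theta_j)=(x,y)$ as $\mathcal{L}_{ij}f(x,y)=\int_0^1\big(f(xu+y(1-u),xu+y(1-u))-f(x,y)\big)\mathrm{Beta}(2s,2s)[du]$.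 $\mathbb{E}_\theta(\bigotimes_i\nu_{\theta_i(t)})$ is the probability measure $A\mapsto\mathbb{E}_\theta\big[(\bigotimes_i\nu_{\theta_i(t)})(A)\big]$. *)

theory Defs
  imports "HOL-Probability.Probability"
begin

section \<open>Markov semigroups and Markov processes with a given generator\<close>

text \<open>
  A conservative Markov semigroup, given by its transition kernels \<open>K t x\<close>, on the measurable space
  \<open>E\<close>, whose generator is \<open>L\<close>: the difference quotients of \<open>t \<mapsto> K t f\<close> at \<open>0\<close> converge to \<open>L f\<close>
  in the supremum norm for every bounded measurable \<open>f\<close>. The domain is all of the bounded
  measurable functions since the generators below have bounded jump rates, hence are bounded
  operators. Only nonnegative times and the restriction of \<open>f\<close> to \<open>space E\<close> matter.
\<close>

definition markov_semigroup ::
  "'a measure \<Rightarrow> (('a \<Rightarrow> real) \<Rightarrow> 'a \<Rightarrow> real) \<Rightarrow> (real \<Rightarrow> 'a \<Rightarrow> 'a measure) \<Rightarrow> bool" where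
  "markov_semigroup E L K \<longleftrightarrow>
     (\<forall>t\<ge>0. K t \<in> E \<rightarrow>\<^sub>M prob_algebra E) \<and>
     (\<forall>x\<in>space E. K 0 x = return E x) \<and>
     (\<forall>t\<ge>0. \<forall>u\<ge>0. \<forall>x\<in>space E. K (t + u) x = K t x \<bind> K u) \<and>
     (\<forall>f\<in>borel_measurable E. bounded (f ` space E) \<longrightarrow>
        uniform_limit (space E) (\<lambda>t x. ((\<integral>y. f y \<partial>K t x) - f x) / t) (L f) (at_right 0))"

definition natural_filtration ::
  "'a measure \<Rightarrow> 'w measure \<Rightarrow> (real \<Rightarrow> 'w \<Rightarrow> 'a) \<Rightarrow> real \<Rightarrow> 'w measure" where
  "natural_filtration E \<Omega> X t =
     sigma (space \<Omega>) (\<Union>r\<in>{0..t}. {X r -` A \<inter> space \<Omega> | A. A \<in> sets E})"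

definition markov_process ::
  "'a measure \<Rightarrow> (real \<Rightarrow> 'a \<Rightarrow> 'a measure) \<Rightarrow> 'w measure \<Rightarrow> (real \<Rightarrow> 'w \<Rightarrow> 'a) \<Rightarrow> bool" where
  "markov_process E K \<Omega> X \<longleftrightarrow>
     prob_space \<Omega> \<and>
     (\<forall>t\<ge>0. X t \<in> \<Omega> \<rightarrow>\<^sub>M E) \<and>
     (\<forall>r\<ge>0. \<forall>t\<ge>0. \<forall>A\<in>sets E. AE \<omega> in \<Omega>.
        real_cond_exp \<Omega> (natural_filtration E \<Omega> X r) (\<lambda>\<omega>. indicator A (X (r + t) \<omega>)) \<omega>
          = measure (K t (X r \<omega>)) A)"

definition markov_process_with_generator ::
  "'a measure \<Rightarrow> (('a \<Rightarrow> real) \<Rightarrow> 'a \<Rightarrow> real) \<Rightarrow> 'w measure \<Rightarrow> (real \<Rightarrow> 'w \<Rightarrow> 'a) \<Rightarrow> bool" where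
  "markov_process_with_generator E L \<Omega> X \<longleftrightarrow>
     (\<exists>K. markov_semigroup E L K \<and> markov_process E K \<Omega> X)"

text \<open>
  The distribution at time \<open>t\<close> of the process with semigroup \<open>S\<close> started from \<open>\<mu>\<close>, written \<open>\<mu> S(t)\<close>;
  see \<open>distr_markov_process\<close> below.
\<close>

definition evolve :: "'a measure \<Rightarrow> (real \<Rightarrow> 'a \<Rightarrow> 'a measure) \<Rightarrow> real \<Rightarrow> 'a measure" where
  "evolve \<mu> S t = \<mu> \<bind> S t"

lemma distr_markov_process:
  assumes S: "markov_semigroup E L S" and X: "markov_process E S \<Omega> X" and t: "0 \<le> t"
  shows "distr \<Omega> E (X t) = evolve (distr \<Omega> E (X 0)) S t"
proof -
  interpret prob_space \<Omega> using X by (simp add: markov_process_def)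
  have m [measurable]: "X t \<in> \<Omega> \<rightarrow>\<^sub>M E" "X 0 \<in> \<Omega> \<rightarrow>\<^sub>M E"
    using X t by (auto simp: markov_process_def)
  have K: "S t \<in> E \<rightarrow>\<^sub>M prob_algebra E"
    using S t by (simp add: markov_semigroup_def)
  have mu: "distr \<Omega> E (X 0) \<in> space (prob_algebra E)"
    by (simp add: space_prob_algebra prob_space_distr)
  let ?F = "natural_filtration E \<Omega> X 0"
  have sub: "(\<Union>r\<in>{0..0}. {X r -` A \<inter> space \<Omega> | A. A \<in> sets E}) \<subseteq> sets \<Omega>"
    by auto
  then have "(\<Union>r\<in>{0..0}. {X r -` A \<inter> space \<Omega> | A. A \<in> sets E}) \<subseteq> Pow (space \<Omega>)"
    using sets.space_closed by blast
  with sub have F: "subalgebra \<Omega> ?F"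
    unfolding subalgebra_def natural_filtration_def
    by (simp add: sets.sigma_sets_subset)
  interpret finite_measure_subalgebra \<Omega> ?F
    by unfold_locales (rule F)
  show ?thesis
  proof (rule measure_eqI)
    show "sets (distr \<Omega> E (X t)) = sets (evolve (distr \<Omega> E (X 0)) S t)"
      using sets_bind'[OF mu K] by (simp add: evolve_def)
  next
    fix A assume "A \<in> sets (distr \<Omega> E (X t))"
    then have A [measurable]: "A \<in> sets E" by simp
    have int: "integrable \<Omega> (\<lambda>\<omega>. indicator A (X t \<omega>) :: real)"
      by (rule integrable_const_bound[where B = 1]) auto
    have AE: "AE \<omega> in \<Omega>. real_cond_exp \<Omega> ?F (\<lambda>\<omega>. indicator A (X t \<omega>)) \<omega> = measure (S t (X 0 \<omega>)) A"
    proof -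
      have "\<forall>r\<ge>0. \<forall>t\<ge>0. \<forall>A\<in>sets E. AE \<omega> in \<Omega>.
          real_cond_exp \<Omega> (natural_filtration E \<Omega> X r) (\<lambda>\<omega>. indicator A (X (r + t) \<omega>)) \<omega>
            = measure (S t (X r \<omega>)) A"
        using X by (simp add: markov_process_def)
      from this[rule_format, OF order_refl t A] show ?thesis by simp
    qed
    have Km: "(\<lambda>x. measure (S t x) A) \<in> borel_measurable E"
      by (rule measurable_compose[OF K measurable_measure_prob_algebra[OF A]])
    have ps: "prob_space (S t x)" if "x \<in> space E" for x
      using measurable_space[OF K that] by (simp add: space_prob_algebra)
    have "emeasure (distr \<Omega> E (X t)) A = ennreal (prob (X t -` A \<inter> space \<Omega>))"
      by (simp add: emeasure_distr emeasure_eq_measure)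
    also have "prob (X t -` A \<inter> space \<Omega>) = (\<integral>\<omega>. indicator A (X t \<omega>) \<partial>\<Omega>)"
    proof -
      have "(\<integral>\<omega>. indicator A (X t \<omega>) \<partial>\<Omega>) = (\<integral>\<omega>. indicator (X t -` A \<inter> space \<Omega>) \<omega> \<partial>\<Omega> :: real)"
        by (intro Bochner_Integration.integral_cong) (auto simp: indicator_def)
      then show ?thesis by simp
    qed
    also have "\<dots> = (\<integral>\<omega>. real_cond_exp \<Omega> ?F (\<lambda>\<omega>. indicator A (X t \<omega>)) \<omega> \<partial>\<Omega>)"
      using real_cond_exp_int(2)[OF int] by simp
    also have "\<dots> = (\<integral>\<omega>. measure (S t (X 0 \<omega>)) A \<partial>\<Omega>)"
      using AE Km by (intro integral_cong_AE) (auto intro: measurable_compose[OF m(2)])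
    also have "ennreal \<dots> = (\<integral>\<^sup>+\<omega>. ennreal (measure (S t (X 0 \<omega>)) A) \<partial>\<Omega>)"
      using Km ps measurable_space[OF m(2)]
      by (intro nn_integral_eq_integral[symmetric] integrable_const_bound[where B = 1])
         (auto intro: measurable_compose[OF m(2)] simp: prob_space.prob_le_1)
    also have "\<dots> = (\<integral>\<^sup>+\<omega>. emeasure (S t (X 0 \<omega>)) A \<partial>\<Omega>)"
      using ps measurable_space[OF m(2)]
      by (intro nn_integral_cong) (simp add: finite_measure.emeasure_eq_measure prob_space_def)
    also have "\<dots> = (\<integral>\<^sup>+x. emeasure (S t x) A \<partial>distr \<Omega> E (X 0))"
      using measurable_compose[OF measurable_prob_algebraD[OF K] measurable_emeasure_subprob_algebra[OF A]]
      by (simp add: nn_integral_distr)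
    also have "\<dots> = emeasure (evolve (distr \<Omega> E (X 0)) S t) A"
      unfolding evolve_def using emeasure_bind_prob_algebra[OF mu K A] by simp
    finally show "emeasure (distr \<Omega> E (X t)) A = emeasure (evolve (distr \<Omega> E (X 0)) S t) A" .
  qed
qed


section \<open>Edge weights\<close>

definition irreducible_weights :: "('v \<Rightarrow> 'v \<Rightarrow> real) \<Rightarrow> bool" where
  "irreducible_weights p \<longleftrightarrow> (\<forall>i j. (i, j) \<in> {(a, b). p a b > 0}\<^sup>*)"


section \<open>The discrete generalized KMP process\<close>

text \<open>
  The underlying space of the Beta distribution is \<open>[0,1]\<close> and not \<open>\<real>\<close>: otherwise the
  integrand in \<open>hidden_edge_gen\<close> would be evaluated outside the state space.
\<close>

definition beta_distribution :: "real \<Rightarrow> real \<Rightarrow> real measure" where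
  "beta_distribution a b =
     density (restrict_space lborel {0..1})
       (\<lambda>u. ennreal (u powr (a - 1) * (1 - u) powr (b - 1) / Beta a b))"

definition beta_binomial :: "real \<Rightarrow> nat \<Rightarrow> nat \<Rightarrow> real" where
  "beta_binomial s n k =
     (\<integral>u. real (n choose k) * u ^ k * (1 - u) ^ (n - k) \<partial>beta_distribution (2 * s) (2 * s))"

definition config_space :: "('v \<Rightarrow> nat) measure" where
  "config_space = PiM UNIV (\<lambda>_. count_space UNIV)"

definition kmp_edge_gen ::
  "real \<Rightarrow> 'v \<Rightarrow> 'v \<Rightarrow> (('v \<Rightarrow> nat) \<Rightarrow> real) \<Rightarrow> ('v \<Rightarrow> nat) \<Rightarrow> real" where
  "kmp_edge_gen s i j f \<eta> =
     (\<Sum>k\<le>\<eta> i + \<eta> j. beta_binomial s (\<eta> i + \<eta> j) k *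
        (f (\<eta>(i := k, j := \<eta> i + \<eta> j - k)) - f \<eta>))"

definition kmp_gen ::
  "('v::finite \<Rightarrow> 'v \<Rightarrow> real) \<Rightarrow> real \<Rightarrow> (('v \<Rightarrow> nat) \<Rightarrow> real) \<Rightarrow> ('v \<Rightarrow> nat) \<Rightarrow> real" where
  "kmp_gen p s f \<eta> = (\<Sum>i\<in>UNIV. \<Sum>j\<in>UNIV - {i}. p i j * kmp_edge_gen s i j f \<eta>)"


section \<open>Discrete Gamma distributions\<close>

definition discrete_gamma :: "real \<Rightarrow> real \<Rightarrow> nat measure" where
  "discrete_gamma s \<theta> =
     density (count_space UNIV)
       (\<lambda>n. ennreal (1 / fact n * (\<theta> / (1 + \<theta>)) ^ n * (Gamma (2 * s + real n) / Gamma (2 * s))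
                      * (1 / (1 + \<theta>)) powr (2 * s)))"

definition discrete_gamma_product :: "real \<Rightarrow> ('v \<Rightarrow> real) \<Rightarrow> ('v \<Rightarrow> nat) measure" where
  "discrete_gamma_product s \<theta> = PiM UNIV (\<lambda>i. discrete_gamma s (\<theta> i))"


section \<open>The hidden parameter model\<close>

definition hidden_space :: "('v \<Rightarrow> real) measure" where
  "hidden_space = PiM UNIV (\<lambda>_. restrict_space borel {0..})"

definition hidden_edge_gen ::
  "real \<Rightarrow> 'v \<Rightarrow> 'v \<Rightarrow> (('v \<Rightarrow> real) \<Rightarrow> real) \<Rightarrow> ('v \<Rightarrow> real) \<Rightarrow> real" where
  "hidden_edge_gen s i j f \<theta> =
     (\<integral>u. f (\<theta>(i := \<theta> i * u + \<theta> j * (1 - u), j := \<theta> i * u + \<theta> j * (1 - u))) - f \<theta>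
        \<partial>beta_distribution (2 * s) (2 * s))"

definition hidden_gen ::
  "('v::finite \<Rightarrow> 'v \<Rightarrow> real) \<Rightarrow> real \<Rightarrow> (('v \<Rightarrow> real) \<Rightarrow> real) \<Rightarrow> ('v \<Rightarrow> real) \<Rightarrow> real" where
  "hidden_gen p s f \<theta> = (\<Sum>i\<in>UNIV. \<Sum>j\<in>UNIV - {i}. p i j * hidden_edge_gen s i j f \<theta>)"


section \<open>Mixtures of products of discrete Gamma distributions\<close>

text \<open>
  For a measurable family \<open>\<kappa>\<close> of probability measures, \<open>\<Xi> \<bind> \<kappa>\<close> is the probability measure
  \<open>A \<mapsto> \<integral> \<kappa> \<theta> A \<Xi>[d\<theta>]\<close>, see \<open>emeasure_bind\<close>. The mixing measures \<open>\<Xi>\<close> live on the parameter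
  set \<open>(0,\<infinity>)\<^sup>V\<close>.
\<close>

definition parameter_space :: "('v \<Rightarrow> real) measure" where
  "parameter_space = PiM UNIV (\<lambda>_. restrict_space borel {0<..})"

definition discrete_gamma_mixtures :: "real \<Rightarrow> ('v \<Rightarrow> nat) measure set" where
  "discrete_gamma_mixtures s =
     {\<Xi> \<bind> discrete_gamma_product s | \<Xi>. \<Xi> \<in> space (prob_algebra parameter_space)}"

end

theory Submission
  imports Defs
begin

text \<open>
  Both generators have the form \<open>c (P - 1)\<close> with the same constant \<open>c\<close>, the total edge weight, and a
  probability kernel \<open>P\<close> that picks a random edge and updates its two endpoints. A Markov semigroup
  with such a generator is unique, namely the Poisson mixture
  \<open>\<Sum>n. exp (- c t) (c t)^n / n! P^n\<close>. It therefore suffices that the product of discrete Gamma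
  distributions intertwines the two one-edge kernels. This reduces to an identity between Beta
  integrals in two variables, which is a fractional linear change of variables. Since the hidden
  kernel preserves \<open>(0,\<infinity>)\<close>, the mixing measure evolves by the same Poisson mixture.
\<close>

section \<open>Markov semigroups with a bounded generator\<close>

text \<open>Why a single edge reduces to one Beta integral: the KMP update keeps the total of the
  two endpoints and redraws the split from a beta-binomial law that depends on the total only. Two
  discrete Gamma variables with a common parameter have this same split given their total. Both
  sides of the one-edge intertwining therefore agree conditionally on the total, and only the law of
  the total is left: the convolution of two negative binomial laws of shape 2s with parameters x and
  y must be a Beta mixture of such laws of shape 4s. In terms of generating functions this is
  Feynman's parametrization, which writes 1 / (a^(2s) b^(2s)) as the Beta(2s,2s) average of (u a +
  (1 - u) b)^(-4s). The hidden model is needed on two state spaces: the process lives on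
  \<open>hidden_space\<close>, which contains the value 0, while mixing measures live on
  \<open>parameter_space\<close>, which does not. The hidden kernels are therefore studied for a
  convex set A of nonnegative reals and used with both half-lines. The claim on mixtures comes with
  no hidden process at all, so the evolved mixing measure has to be built explicitly.\<close>

lemma integral_kernel_measurable:
  fixes f :: "'b \<Rightarrow> real"
  assumes K: "K \<in> M \<rightarrow>\<^sub>M prob_algebra N" and f: "f \<in> borel_measurable N"
  shows "(\<lambda>x. \<integral>y. f y \<partial>K x) \<in> borel_measurable M"
  using measurable_compose[OF measurable_prob_algebraD[OF K] integral_measurable_subprob_algebra[OF f]] .

lemma kernel_space:
  assumes "K \<in> M \<rightarrow>\<^sub>M prob_algebra N" "x \<in> space M"
  shows "prob_space (K x)" "sets (K x) = sets N" "space (K x) = space N"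
  using measurable_space[OF assms] sets_eq_imp_space_eq by (auto simp: space_prob_algebra)

lemma integrable_kernel:
  fixes f :: "'b \<Rightarrow> real"
  assumes K: "K \<in> M \<rightarrow>\<^sub>M prob_algebra N" and x: "x \<in> space M"
    and f: "f \<in> borel_measurable N" and B: "\<And>y. y \<in> space N \<Longrightarrow> \<bar>f y\<bar> \<le> B"
  shows "integrable (K x) f"
proof -
  interpret prob_space "K x" using kernel_space[OF K x] by simp
  show ?thesis
    using f kernel_space[OF K x] B
    by (intro integrable_const_bound[where B=B]) (auto cong: measurable_cong_sets)
qed

lemma integral_kernel_abs_le:
  fixes f :: "'b \<Rightarrow> real"
  assumes K: "K \<in> M \<rightarrow>\<^sub>M prob_algebra N" and x: "x \<in> space M"
    and f: "f \<in> borel_measurable N" and B: "\<And>y. y \<in> space N \<Longrightarrow> \<bar>f y\<bar> \<le> B"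
  shows "\<bar>\<integral>y. f y \<partial>K x\<bar> \<le> B"
proof -
  interpret prob_space "K x" using kernel_space[OF K x] by simp
  have "\<bar>\<integral>y. f y \<partial>K x\<bar> \<le> (\<integral>y. \<bar>f y\<bar> \<partial>K x)"
    by (rule integral_abs_bound)
  also have "\<dots> \<le> (\<integral>y. B \<partial>K x)"
    using integrable_kernel[OF assms] kernel_space[OF K x] B by (intro integral_mono) auto
  also have "\<dots> = B" by (simp add: prob_space)
  finally show ?thesis .
qed

lemma integral_bind_kernel:
  fixes f :: "'c \<Rightarrow> real"
  assumes \<mu>: "\<mu> \<in> space (prob_algebra M)" and K: "K \<in> M \<rightarrow>\<^sub>M prob_algebra N"
    and f: "f \<in> borel_measurable N" and B: "\<And>y. y \<in> space N \<Longrightarrow> \<bar>f y\<bar> \<le> B"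
  shows "(\<integral>y. f y \<partial>(\<mu> \<bind> K)) = (\<integral>x. \<integral>y. f y \<partial>K x \<partial>\<mu>)"
proof -
  interpret prob_space \<mu> using \<mu> by (simp add: space_prob_algebra)
  have s: "sets \<mu> = sets M" using \<mu> by (simp add: space_prob_algebra)
  have K': "K \<in> \<mu> \<rightarrow>\<^sub>M prob_algebra N" using K by (simp cong: measurable_cong_sets add: s)
  have "emeasure (K x) (space (K x)) \<le> 1" if "x \<in> space \<mu>" for x
    using prob_space.emeasure_space_1[OF kernel_space(1)[OF K' that]] by simp
  then show ?thesis
    by (intro integral_bind[where K=N and B=B and B'=1])
       (use K' f B kernel_space[OF K'] in \<open>auto intro!: measurable_prob_algebraD\<close>)
qed

section \<open>Differentiability in time of a semigroup whose generator is bounded\<close>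

context
  fixes E :: "'a measure" and K :: "real \<Rightarrow> 'a \<Rightarrow> 'a measure" and L
  assumes K: "markov_semigroup E L K"
begin

lemma semigroup_kernel: "0 \<le> t \<Longrightarrow> K t \<in> E \<rightarrow>\<^sub>M prob_algebra E"
  using K by (simp add: markov_semigroup_def)

lemma semigroup_integral_add:
  fixes f :: "'a \<Rightarrow> real"
  assumes "0 \<le> t" "0 \<le> u" "x \<in> space E" "f \<in> borel_measurable E"
    and "\<And>y. y \<in> space E \<Longrightarrow> \<bar>f y\<bar> \<le> B"
  shows "(\<integral>y. f y \<partial>K (t + u) x) = (\<integral>z. \<integral>y. f y \<partial>K u z \<partial>K t x)"
proof -
  have "K (t + u) x = K t x \<bind> K u"
    using K assms by (simp add: markov_semigroup_def)
  moreover have "K t x \<in> space (prob_algebra E)"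
    by (rule measurable_space[OF semigroup_kernel[OF assms(1)] assms(3)])
  ultimately show ?thesis
    using integral_bind_kernel[OF _ semigroup_kernel[OF assms(2)] assms(4,5)] by simp
qed

text \<open>The definition of the generator speaks about time 0 only. Averaging the expansion at 0
  over \<open>K r x\<close> moves it to time r by the semigroup property. Since the convergence is
  uniform in the starting point, the error bound survives the averaging, and \<open>d\<close>
  depends neither on \<open>r\<close> nor on \<open>x\<close>.\<close>

lemma semigroup_first_order:
  fixes f :: "'a \<Rightarrow> real"
  assumes f: "f \<in> borel_measurable E" "\<And>y. y \<in> space E \<Longrightarrow> \<bar>f y\<bar> \<le> B"
    and Lf: "L f \<in> borel_measurable E" "\<And>y. y \<in> space E \<Longrightarrow> \<bar>L f y\<bar> \<le> B'"
    and e: "0 < e"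
  obtains d where "0 < d"
    "\<And>r h x. 0 \<le> r \<Longrightarrow> 0 \<le> h \<Longrightarrow> h < d \<Longrightarrow> x \<in> space E \<Longrightarrow>
      \<bar>(\<integral>y. f y \<partial>K (r + h) x) - (\<integral>y. f y \<partial>K r x) - h * (\<integral>y. L f y \<partial>K r x)\<bar> \<le> e * h"
proof -
  have "bounded (f ` space E)" using f(2) by (auto simp: bounded_iff)
  then have "uniform_limit (space E) (\<lambda>t x. ((\<integral>y. f y \<partial>K t x) - f x) / t) (L f) (at_right 0)"
    using K f by (simp add: markov_semigroup_def)
  from uniform_limitD[OF this e] obtain d where d: "0 < d"
    "\<And>h x. 0 < h \<Longrightarrow> h < d \<Longrightarrow> x \<in> space E \<Longrightarrow> dist (((\<integral>y. f y \<partial>K h x) - f x) / h) (L f x) < e"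
    by (auto simp: eventually_at_right_field)
  have *: "\<bar>(\<integral>y. f y \<partial>K h x) - f x - h * L f x\<bar> \<le> e * h" if "0 < h" "h < d" "x \<in> space E" for h x
  proof -
    have "\<bar>((\<integral>y. f y \<partial>K h x) - f x) / h - L f x\<bar> * h \<le> e * h"
      using d(2)[OF that] that by (intro mult_right_mono) (auto simp: dist_real_def)
    then show ?thesis using that by (simp add: abs_mult_pos field_simps)
  qed
  show thesis
  proof (rule that[OF d(1)])
    fix r h :: real and x assume r: "0 \<le> r" and h: "0 \<le> h" "h < d" and x: "x \<in> space E"
    note Kr = semigroup_kernel[OF r] and Kh = semigroup_kernel[OF h(1)]
    have m: "(\<lambda>z. \<integral>y. f y \<partial>K h z) \<in> borel_measurable E"
      by (rule integral_kernel_measurable[OF Kh f(1)])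
    have i: "integrable (K r x) (\<lambda>z. \<integral>y. f y \<partial>K h z)"
      by (rule integrable_kernel[OF Kr x m integral_kernel_abs_le[OF Kh _ f]])
    note i' = integrable_kernel[OF Kr x f] integrable_kernel[OF Kr x Lf]
    show "\<bar>(\<integral>y. f y \<partial>K (r + h) x) - (\<integral>y. f y \<partial>K r x) - h * (\<integral>y. L f y \<partial>K r x)\<bar> \<le> e * h"
    proof (cases "h = 0")
      case False
      then have "\<bar>\<integral>z. ((\<integral>y. f y \<partial>K h z) - f z - h * L f z) \<partial>K r x\<bar> \<le> e * h"
        using h by (intro integral_kernel_abs_le[OF Kr x] *) (auto intro!: borel_measurable_diff borel_measurable_times m f Lf)
      then show ?thesis
        using semigroup_integral_add[OF r h(1) x f] i i' by simp
    qed simp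
  qed
qed

text \<open>The first-order expansion gives right derivatives. For the left derivative at
  \<open>r\<close> the expansion is taken at the earlier time \<open>y\<close>, and the slope at
  \<open>y\<close> is then replaced by the slope at \<open>r\<close>. The price is a Lipschitz bound
  in time for the average of \<open>L f\<close>, which is where \<open>L (L f)\<close>
  enters.\<close>

lemma semigroup_has_derivative:
  fixes f :: "'a \<Rightarrow> real"
  assumes f: "f \<in> borel_measurable E" "\<And>y. y \<in> space E \<Longrightarrow> \<bar>f y\<bar> \<le> B"
    and Lf: "L f \<in> borel_measurable E" "\<And>y. y \<in> space E \<Longrightarrow> \<bar>L f y\<bar> \<le> B'"
    and LLf: "L (L f) \<in> borel_measurable E" "\<And>y. y \<in> space E \<Longrightarrow> \<bar>L (L f) y\<bar> \<le> B''"
    and x: "x \<in> space E" and r: "0 \<le> r"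
  shows "((\<lambda>r. \<integral>y. f y \<partial>K r x) has_field_derivative (\<integral>y. L f y \<partial>K r x)) (at r within {0..})"
proof -
  let ?T = "\<lambda>f r. \<integral>y. f y \<partial>K r x"
  \<comment> \<open>Accuracy 1 is enough here, because the expansion only serves to produce some
    Lipschitz constant, namely \<open>1 + B''\<close>.\<close>
  obtain d' where d': "0 < d'"
    "\<And>r h. 0 \<le> r \<Longrightarrow> 0 \<le> h \<Longrightarrow> h < d' \<Longrightarrow> \<bar>?T (L f) (r + h) - ?T (L f) r - h * ?T (L (L f)) r\<bar> \<le> 1 * h"
    using x by (auto intro: semigroup_first_order[OF Lf LLf zero_less_one])
  have "0 \<le> B''" using LLf(2)[OF x] by simp
  have lip: "\<bar>?T (L f) (r + h) - ?T (L f) r\<bar> \<le> (1 + B'') * h" if "0 \<le> r" "0 \<le> h" "h < d'" for r h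
  proof -
    have "\<bar>h * ?T (L (L f)) r\<bar> \<le> h * B''"
      using integral_kernel_abs_le[OF semigroup_kernel[OF that(1)] x LLf] that
      by (simp add: abs_mult mult_left_mono)
    with d'(2)[OF that] show ?thesis by (simp add: algebra_simps)
  qed
  show ?thesis
    unfolding has_field_derivative_def has_derivative_within_alt
  proof (intro conjI allI impI bounded_linear_mult_right)
    fix e :: real assume e: "0 < e"
    obtain d where d: "0 < d"
      "\<And>r h. 0 \<le> r \<Longrightarrow> 0 \<le> h \<Longrightarrow> h < d \<Longrightarrow> \<bar>?T f (r + h) - ?T f r - h * ?T (L f) r\<bar> \<le> e / 2 * h"
      using x by (auto intro: semigroup_first_order[OF f Lf half_gt_zero[OF e]])
    \<comment> \<open>The last term keeps the Lipschitz error \<open>(1 + B'') * h\<^sup>2\<close>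
      below \<open>e / 2 * h\<close>; the other half of \<open>e\<close> pays for the first-order
      remainder.\<close>
    define D where "D = min (min d d') (e / (2 * (1 + B'')))"
    have D: "0 < D" using d d' e \<open>0 \<le> B''\<close> by (simp add: D_def)
    show "\<exists>d>0. \<forall>y\<in>{0..}. norm (y - r) < d \<longrightarrow>
       norm (?T f y - ?T f r - ?T (L f) r * (y - r)) \<le> e * norm (y - r)"
    proof (intro exI[of _ D] conjI D ballI impI)
      fix y :: real assume y: "y \<in> {0..}" "norm (y - r) < D"
      show "norm (?T f y - ?T f r - ?T (L f) r * (y - r)) \<le> e * norm (y - r)"
      proof (cases "r \<le> y")
        case True
        have "\<bar>?T f (r + (y - r)) - ?T f r - (y - r) * ?T (L f) r\<bar> \<le> e / 2 * (y - r)"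
          using True y r by (intro d(2)) (auto simp: D_def)
        also have "\<dots> \<le> e * (y - r)" using e True by (intro mult_right_mono) auto
        finally show ?thesis using True by (simp add: mult.commute)
      next
        case False
        define h where "h = r - y"
        have h: "0 \<le> h" "h < d" "h < d'" "h * (1 + B'') \<le> e / 2" "r = y + h"
          using False y \<open>0 \<le> B''\<close> by (auto simp: h_def D_def field_simps)
        have 1: "\<bar>?T f (y + h) - ?T f y - h * ?T (L f) y\<bar> \<le> e / 2 * h"
          using h y by (intro d(2)) auto
        have "\<bar>h * (?T (L f) (y + h) - ?T (L f) y)\<bar> \<le> h * ((1 + B'') * h)"
          using lip[of y h] h y by (simp add: abs_mult mult_left_mono)
        also have "\<dots> \<le> e / 2 * h"
          using mult_right_mono[OF h(4) h(1)] by (simp add: mult_ac)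
        finally have "\<bar>?T f (y + h) - ?T f y - h * ?T (L f) (y + h)\<bar> \<le> e * h"
          using 1 unfolding right_diff_distrib by linarith
        then show ?thesis using h by (simp add: algebra_simps abs_minus_commute)
      qed
    qed
  qed
qed

end

section \<open>Uniformization: iterates of a kernel at Poisson times\<close>

fun kernel_power :: "'a measure \<Rightarrow> ('a \<Rightarrow> 'a measure) \<Rightarrow> nat \<Rightarrow> 'a \<Rightarrow> 'a measure" where
  "kernel_power E P 0 = return E"
| "kernel_power E P (Suc n) = (\<lambda>x. P x \<bind> kernel_power E P n)"

lemma measurable_kernel_power:
  "P \<in> E \<rightarrow>\<^sub>M prob_algebra E \<Longrightarrow> kernel_power E P n \<in> E \<rightarrow>\<^sub>M prob_algebra E"
  by (induction n) (auto intro: measurable_bind_prob_space)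

definition uniformized :: "'a measure \<Rightarrow> real \<Rightarrow> ('a \<Rightarrow> 'a measure) \<Rightarrow> real \<Rightarrow> 'a \<Rightarrow> 'a measure" where
  "uniformized E c P t x = measure_pmf (poisson_pmf (c * t)) \<bind> (\<lambda>n. kernel_power E P n x)"

lemma measurable_pmf_mixture:
  fixes q :: "'i::countable pmf"
  assumes "\<And>n. k n \<in> M \<rightarrow>\<^sub>M prob_algebra N"
  shows "(\<lambda>x. measure_pmf q \<bind> (\<lambda>n. k n x)) \<in> M \<rightarrow>\<^sub>M prob_algebra N"
proof (rule measurable_bind_prob_space2[where N="count_space UNIV"])
  show "(\<lambda>x. measure_pmf q) \<in> M \<rightarrow>\<^sub>M prob_algebra (count_space UNIV)"
    by (auto simp: space_prob_algebra prob_space_measure_pmf)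
  show "(\<lambda>(x, n). k n x) \<in> M \<Otimes>\<^sub>M count_space UNIV \<rightarrow>\<^sub>M prob_algebra N"
    unfolding split_beta
    by (rule measurable_compose_countable[where f="\<lambda>n p. k n (fst p)" and g=snd])
       (auto intro: measurable_compose[OF measurable_fst assms])
qed

lemma measurable_uniformized:
  "P \<in> E \<rightarrow>\<^sub>M prob_algebra E \<Longrightarrow> uniformized E c P t \<in> E \<rightarrow>\<^sub>M prob_algebra E"
  unfolding uniformized_def [abs_def] by (intro measurable_pmf_mixture measurable_kernel_power)

text \<open>Uniqueness by Taylor expansion in time of the probability of a fixed event. All
  derivatives at 0 are given by the iterates of \<open>P\<close>, since \<open>K 0\<close> is the
  identity, and these iterates are bounded by 1 at every time, so the remainder vanishes and the
  series determines the value at \<open>t\<close>.\<close>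

lemma semigroup_uniformization:
  assumes K: "markov_semigroup E L K" and P: "P \<in> E \<rightarrow>\<^sub>M prob_algebra E" and c: "0 < c"
    and L: "\<And>f x. f \<in> borel_measurable E \<Longrightarrow> bounded (f ` space E) \<Longrightarrow> x \<in> space E \<Longrightarrow>
              L f x = c * ((\<integral>y. f y \<partial>P x) - f x)"
    and t: "0 < t" and x: "x \<in> space E"
  shows "K t x = uniformized E c P t x"
proof (rule measure_eqI)
  note kp = measurable_kernel_power[OF P]
  note Kt = kernel_space[OF semigroup_kernel[OF K less_imp_le[OF t]] x]
  note Ut = kernel_space[OF measurable_uniformized[OF P] x]
  show "sets (K t x) = sets (uniformized E c P t x)"
    using Kt Ut by simp
  fix A assume "A \<in> sets (K t x)"
  then have A: "A \<in> sets E" using Kt by simp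
  \<comment> \<open>\<open>g n\<close> is the n-th iterate of \<open>P\<close> applied to the
    indicator of \<open>A\<close>. On this sequence \<open>L\<close> acts as \<open>c\<close> times
    a difference of neighbours, so differentiating in time never leads outside it.\<close>
  define g where "g n x = measure (kernel_power E P n x) A" for n x
  have g_m: "g n \<in> borel_measurable E" for n
    unfolding g_def [abs_def] by (rule measurable_compose[OF kp measurable_measure_prob_algebra[OF A]])
  have g_b: "\<bar>g n y\<bar> \<le> 1" if "y \<in> space E" for n y
    using kernel_space[OF kp that] by (simp add: g_def prob_space.prob_le_1)
  have g_bdd: "bounded (g n ` space E)" for n
    using g_b by (auto simp: bounded_iff)
  have g_Suc: "(\<integral>y. g n y \<partial>P x) = g (Suc n) x" if "x \<in> space E" for n x
  proof -
    have "(\<integral>y. indicator A y \<partial>(P x \<bind> kernel_power E P n)) = (\<integral>y. g n y \<partial>P x)"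
      using A kernel_space[OF kp]
      by (subst integral_bind_kernel[OF measurable_space[OF P that] kp, where B=1])
         (auto simp: g_def indicator_def kernel_space[OF P that] intro!: Bochner_Integration.integral_cong)
    moreover have "A \<in> sets (P x \<bind> kernel_power E P n)"
      using kernel_space[OF kp[of "Suc n"] that] A by simp
    ultimately show ?thesis by (simp add: g_def)
  qed
  have Lg: "L (g n) y = c * (g (Suc n) y - g n y)" if "y \<in> space E" for n y
    using L[OF g_m g_bdd that] g_Suc[OF that] by simp
  have Lg_m: "L (g n) \<in> borel_measurable E" for n
    by (subst measurable_cong[OF Lg]) (auto intro!: borel_measurable_times borel_measurable_diff g_m)
  have Lg_b: "\<bar>L (g n) y\<bar> \<le> 2 * c" if "y \<in> space E" for n y
  proof -
    have "\<bar>g (Suc n) y - g n y\<bar> \<le> 2" using g_b[OF that, of "Suc n"] g_b[OF that, of n] by linarith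
    then show ?thesis using c by (simp add: Lg[OF that] abs_mult mult.commute)
  qed
  have Lg_bdd: "bounded (L (g n) ` space E)" for n
    using Lg_b by (auto simp: bounded_iff)
  have LLg: "L (L (g n)) y = c * ((\<integral>z. L (g n) z \<partial>P y) - L (g n) y)" if "y \<in> space E" for n y
    by (rule L[OF Lg_m Lg_bdd that])
  have LLg_m: "L (L (g n)) \<in> borel_measurable E" for n
    by (subst measurable_cong[OF LLg])
       (auto intro!: borel_measurable_times borel_measurable_diff Lg_m integral_kernel_measurable[OF P])
  have LLg_b: "\<bar>L (L (g n)) y\<bar> \<le> c * (2 * c + 2 * c)" if "y \<in> space E" for n y
    unfolding LLg[OF that] using integral_kernel_abs_le[OF P that Lg_m Lg_b, of n] Lg_b[OF that, of n] c
    by (simp add: abs_mult)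
  \<comment> \<open>The factor \<open>exp (c * r)\<close> removes the \<open>-1\<close> from \<open>L = c (P - 1)\<close>, so that \<open>F (Suc n)\<close> is the derivative of \<open>F n\<close>.\<close>
  define F where "F n r = exp (c * r) * c ^ n * (\<integral>y. g n y \<partial>K r x)" for n r
  have F': "(F n has_field_derivative F (Suc n) r) (at r within {0..t})" if "r \<in> {0..t}" for n r
  proof -
    note Kr = semigroup_kernel[OF K, of r]
    have "(\<integral>y. L (g n) y \<partial>K r x) = (\<integral>y. c * (g (Suc n) y - g n y) \<partial>K r x)"
      using kernel_space[OF Kr x] that by (intro Bochner_Integration.integral_cong refl) (auto simp: Lg)
    also have "\<dots> = c * ((\<integral>y. g (Suc n) y \<partial>K r x) - (\<integral>y. g n y \<partial>K r x))"
      using integrable_kernel[OF Kr x g_m g_b] that by simp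
    finally have Ti: "(\<integral>y. L (g n) y \<partial>K r x) = c * ((\<integral>y. g (Suc n) y \<partial>K r x) - (\<integral>y. g n y \<partial>K r x))" .
    have "((\<lambda>r. \<integral>y. g n y \<partial>K r x) has_field_derivative (\<integral>y. L (g n) y \<partial>K r x)) (at r within {0..t})"
      by (rule DERIV_subset[OF semigroup_has_derivative[OF K g_m g_b Lg_m Lg_b LLg_m LLg_b x]])
         (use that in auto)
    then show ?thesis
      unfolding F_def [abs_def] by (auto intro!: derivative_eq_intros simp: Ti algebra_simps)
  qed
  have F0: "F n 0 = c ^ n * g n x" for n
  proof -
    have "K 0 x = return E x" using K x by (simp add: markov_semigroup_def)
    then show ?thesis using x g_m by (simp add: F_def integral_return)
  qed
  have Ft: "F 0 t = exp (c * t) * measure (K t x) A"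
  proof -
    have "(\<integral>y. g 0 y \<partial>K t x) = (\<integral>y. indicator A y \<partial>K t x)"
      using A Kt by (intro Bochner_Integration.integral_cong refl) (auto simp: g_def measure_return)
    then show ?thesis using A Kt by (simp add: F_def)
  qed
  \<comment> \<open>The Taylor bound has \<open>fact n\<close> rather than
    \<open>fact (Suc n)\<close> in the denominator. Splitting off one factor \<open>c * t\<close>
    still leaves the null sequence \<open>(c * t) ^ n / fact n\<close>.\<close>
  have Taylor: "norm (F 0 t - (\<Sum>i\<le>n. F i 0 * (t - 0) ^ i / fact i)) \<le> (exp (c * t) * c ^ Suc n) * norm (t - 0) ^ Suc n / fact n" for n
  proof (rule field_Taylor[of "{0..t}" n F])
    fix r assume r: "r \<in> {0..t}"
    have "\<bar>\<integral>y. g (Suc n) y \<partial>K r x\<bar> \<le> 1"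
      using r by (intro integral_kernel_abs_le[OF semigroup_kernel[OF K] x g_m g_b]) auto
    then have "exp (c * r) * c ^ Suc n * \<bar>\<integral>y. g (Suc n) y \<partial>K r x\<bar> \<le> exp (c * t) * c ^ Suc n * 1"
      using r c by (intro mult_mono) auto
    then show "norm (F (Suc n) r) \<le> exp (c * t) * c ^ Suc n"
      using c by (simp add: F_def abs_mult)
  qed (use F' t in auto)
  have "(\<lambda>n. \<Sum>i\<le>n. F i 0 * t ^ i / fact i) \<longlonglongrightarrow> F 0 t"
  proof (rule Lim_null[THEN iffD2, OF Lim_null_comparison])
    have "(\<lambda>n. (c * t) ^ n / fact n) \<longlonglongrightarrow> 0"
      using summable_LIMSEQ_zero[OF summable_exp[of "c * t"]] by (simp add: divide_inverse mult.commute)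
    then have "(\<lambda>n. exp (c * t) * (c * t) * ((c * t) ^ n / fact n)) \<longlonglongrightarrow> exp (c * t) * (c * t) * 0"
      by (intro tendsto_intros)
    then show "(\<lambda>n. (exp (c * t) * c ^ Suc n) * norm (t - 0) ^ Suc n / fact n) \<longlonglongrightarrow> 0"
      using t by (simp add: power_mult_distrib mult_ac)
    show "\<forall>\<^sub>F n in sequentially. norm ((\<Sum>i\<le>n. F i 0 * t ^ i / fact i) - F 0 t) \<le> (exp (c * t) * c ^ Suc n) * norm (t - 0) ^ Suc n / fact n"
      using Taylor by (intro always_eventually allI) (simp only: diff_0_right norm_minus_commute)
  qed
  then have "(\<lambda>i. F i 0 * t ^ i / fact i) sums F 0 t"
    by (simp add: sums_def_le)
  \<comment> \<open>Undoing the factor \<open>exp (c * t)\<close> in \<open>F 0 t\<close> turns the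
    coefficients of the exponential series into Poisson weights.\<close>
  then have "(\<lambda>i. exp (- (c * t)) * (F i 0 * t ^ i / fact i)) sums (exp (- (c * t)) * F 0 t)"
    by (rule sums_mult)
  then have sums: "(\<lambda>n. pmf (poisson_pmf (c * t)) n * g n x) sums measure (K t x) A"
    using c t by (simp add: F0 Ft exp_minus field_simps power_mult_distrib)
  have "emeasure (uniformized E c P t x) A = (\<integral>\<^sup>+n. emeasure (kernel_power E P n x) A \<partial>poisson_pmf (c * t))"
    unfolding uniformized_def
    by (rule emeasure_bind_prob_algebra[OF _ _ A, where N="count_space UNIV"])
       (auto simp: space_prob_algebra prob_space_measure_pmf kernel_space[OF kp x])
  also have "\<dots> = (\<Sum>n. ennreal (pmf (poisson_pmf (c * t)) n) * ennreal (g n x))"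
    using kernel_space[OF kp x]
    by (simp add: measure_pmf_eq_density nn_integral_density nn_integral_count_space_nat g_def
        finite_measure.emeasure_eq_measure prob_space_def)
  also have "\<dots> = (\<Sum>n. ennreal (pmf (poisson_pmf (c * t)) n * g n x))"
    by (simp add: ennreal_mult' g_def)
  also have "\<dots> = ennreal (measure (K t x) A)"
    using sums by (intro suminf_ennreal_eq) (auto simp: g_def)
  also have "\<dots> = emeasure (K t x) A"
    using Kt by (simp add: finite_measure.emeasure_eq_measure prob_space_def)
  finally show "emeasure (K t x) A = emeasure (uniformized E c P t x) A" by simp
qed

section \<open>Discrete Gamma distributions\<close>

text \<open>A finite product of countable discrete spaces is discrete. Measurability on
  configurations becomes trivial, and measures there may be compared on singletons.\<close>

lemma config_space_eq: "config_space = (count_space UNIV :: ('v::finite \<Rightarrow> nat) measure)"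
  unfolding config_space_def by (subst count_space_PiM_finite) (auto simp: PiE_UNIV_domain)

text \<open>The negative binomial weights of shape 2s. Writing the Gamma quotient as a Pochhammer
  symbol lets products of weights be handled by algebra alone.\<close>

definition discrete_gamma_mass :: "real \<Rightarrow> real \<Rightarrow> nat \<Rightarrow> real" where
  "discrete_gamma_mass s \<theta> n = pochhammer (2 * s) n / fact n * (\<theta> / (1 + \<theta>)) ^ n * (1 / (1 + \<theta>)) powr (2 * s)"

lemma discrete_gamma_mass_nonneg: "0 < s \<Longrightarrow> 0 \<le> \<theta> \<Longrightarrow> 0 \<le> discrete_gamma_mass s \<theta> n"
  by (simp add: discrete_gamma_mass_def pochhammer_nonneg)

lemma discrete_gamma_eq:
  assumes "0 < s"
  shows "discrete_gamma s \<theta> = density (count_space UNIV) (\<lambda>n. ennreal (discrete_gamma_mass s \<theta> n))"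
proof -
  have "2 * s \<notin> \<int>\<^sub>\<le>\<^sub>0" using assms by (auto elim!: nonpos_Ints_cases)
  then show ?thesis
    by (simp add: discrete_gamma_def discrete_gamma_mass_def pochhammer_Gamma mult_ac)
qed

text \<open>Newton's series for (1 - q)^(-2s) with q = \<theta> / (1 + \<theta>); the sign of the
  generalized binomial coefficient cancels that of (-q)^n.\<close>

lemma discrete_gamma_mass_sums:
  assumes s: "0 < s" and \<theta>: "0 \<le> \<theta>"
  shows "discrete_gamma_mass s \<theta> sums 1"
proof -
  define q where "q = \<theta> / (1 + \<theta>)"
  have q: "\<bar>- q\<bar> < 1" "1 - q = 1 / (1 + \<theta>)" using \<theta> by (auto simp: q_def field_simps)
  have "(\<lambda>n. ((- (2 * s)) gchoose n) * (- q) ^ n) sums (1 + - q) powr (- (2 * s))"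
    by (rule gen_binomial_real[OF q(1)])
  moreover have "((- (2 * s)) gchoose n) * (- q) ^ n = pochhammer (2 * s) n / fact n * q ^ n" for n
    by (simp add: gbinomial_pochhammer power_mult_distrib[symmetric])
  ultimately have "(\<lambda>n. pochhammer (2 * s) n / fact n * q ^ n) sums (1 / (1 + \<theta>)) powr (- (2 * s))"
    using q(2) by simp
  from sums_mult2[OF this, of "(1 / (1 + \<theta>)) powr (2 * s)"] show ?thesis
    using \<theta> by (simp add: discrete_gamma_mass_def [abs_def] q_def powr_add[symmetric])
qed

lemma prob_space_discrete_gamma:
  assumes s: "0 < s" and \<theta>: "0 \<le> \<theta>"
  shows "prob_space (discrete_gamma s \<theta>)"
proof
  have "emeasure (discrete_gamma s \<theta>) (space (discrete_gamma s \<theta>)) = (\<Sum>n. ennreal (discrete_gamma_mass s \<theta> n))"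
    by (simp add: discrete_gamma_eq[OF s] emeasure_density nn_integral_count_space_nat)
  also have "\<dots> = 1"
    using suminf_ennreal_eq[OF discrete_gamma_mass_nonneg[OF s \<theta>] discrete_gamma_mass_sums[OF s \<theta>]] by simp
  finally show "emeasure (discrete_gamma s \<theta>) (space (discrete_gamma s \<theta>)) = 1" .
qed

lemma sets_discrete_gamma_product:
  "sets (discrete_gamma_product s \<theta>) = sets (config_space :: ('v::finite \<Rightarrow> nat) measure)"
  unfolding discrete_gamma_product_def config_space_def
  by (intro sets_PiM_cong) (auto simp: discrete_gamma_def)

lemma prob_space_discrete_gamma_product:
  assumes "0 < s" "\<And>i. 0 \<le> \<theta> i"
  shows "prob_space (discrete_gamma_product s (\<theta> :: 'v::finite \<Rightarrow> real))"
  unfolding discrete_gamma_product_def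
  by (intro prob_space_PiM prob_space_discrete_gamma assms)

lemma emeasure_discrete_gamma_product_singleton:
  assumes s: "0 < s" and \<theta>: "\<And>i. 0 \<le> \<theta> i"
  shows "emeasure (discrete_gamma_product s \<theta>) {\<eta>} = ennreal (\<Prod>i\<in>UNIV. discrete_gamma_mass s (\<theta> i) (\<eta> (i::'v::finite)))"
proof -
  interpret product_sigma_finite "\<lambda>i. discrete_gamma s (\<theta> i)"
    using prob_space_discrete_gamma[OF s \<theta>]
    by (simp add: product_sigma_finite_def prob_space_imp_sigma_finite)
  have "{\<eta>} = Pi\<^sub>E UNIV (\<lambda>i. {\<eta> i})" by (auto simp: PiE_UNIV_domain)
  then have "emeasure (discrete_gamma_product s \<theta>) {\<eta>} = (\<Prod>i\<in>UNIV. emeasure (discrete_gamma s (\<theta> i)) {\<eta> i})"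
    unfolding discrete_gamma_product_def by (simp only:, subst emeasure_PiM) (auto simp: discrete_gamma_def)
  also have "\<dots> = (\<Prod>i\<in>UNIV. ennreal (discrete_gamma_mass s (\<theta> i) (\<eta> i)))"
    by (simp add: discrete_gamma_eq[OF s] emeasure_density)
  also have "\<dots> = ennreal (\<Prod>i\<in>UNIV. discrete_gamma_mass s (\<theta> i) (\<eta> i))"
    by (rule prod_ennreal) (rule discrete_gamma_mass_nonneg[OF s \<theta>])
  finally show ?thesis .
qed

text \<open>The target is countable and discrete, so singletons generate its sigma-algebra and only
  products of explicit weights have to be measurable. The empty set is added to make the generator
  closed under intersections.\<close>

lemma measurable_discrete_gamma_product:
  assumes s: "0 < s" and A: "A \<subseteq> {0..}"
  shows "discrete_gamma_product s \<in> PiM UNIV (\<lambda>_. restrict_space borel A) \<rightarrow>\<^sub>M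
           prob_algebra (config_space :: ('v::finite \<Rightarrow> nat) measure)"
    (is "_ \<in> ?M \<rightarrow>\<^sub>M _")
proof (rule measurable_prob_algebra_generated[where \<Omega>=UNIV and G="insert {} (range (\<lambda>\<eta>. {\<eta>}))"])
  show "sets (config_space :: ('v \<Rightarrow> nat) measure) = sigma_sets UNIV (insert {} (range (\<lambda>\<eta>. {\<eta>})))"
  proof -
    have "X \<in> sigma_sets UNIV (insert {} (range (\<lambda>\<eta>::'v \<Rightarrow> nat. {\<eta>})))" for X
    proof -
      have "(\<Union>\<eta>\<in>X. {\<eta>}) \<in> sigma_sets UNIV (insert {} (range (\<lambda>\<eta>::'v \<Rightarrow> nat. {\<eta>})))"
        by (rule sigma_sets_UNION) (auto intro: countable_subset[OF subset_UNIV])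
      then show ?thesis by simp
    qed
    then show ?thesis by (auto simp: config_space_eq)
  qed
  show "Int_stable (insert {} (range (\<lambda>\<eta>::'v \<Rightarrow> nat. {\<eta>})))"
    by (auto simp: Int_stable_def)
  have nn: "0 \<le> \<theta> i" if "\<theta> \<in> space ?M" for \<theta> :: "'v \<Rightarrow> real" and i
    using that A by (auto simp: space_PiM space_restrict_space)
  show "prob_space (discrete_gamma_product s \<theta>)" if "\<theta> \<in> space ?M" for \<theta> :: "'v \<Rightarrow> real"
    using nn[OF that] s by (intro prob_space_discrete_gamma_product)
  fix X :: "('v \<Rightarrow> nat) set" assume "X \<in> insert {} (range (\<lambda>\<eta>. {\<eta>}))"
  then consider "X = {}" | \<eta> where "X = {\<eta>}" by auto
  then show "(\<lambda>\<theta>. emeasure (discrete_gamma_product s \<theta>) X) \<in> borel_measurable ?M"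
  proof cases
    case 2
    have c: "(\<lambda>\<theta>. \<theta> i) \<in> borel_measurable ?M" for i
      by (rule measurable_compose[OF measurable_component_singleton[OF UNIV_I]])
         (rule measurable_restrict_space1, simp)
    have "(\<lambda>\<theta>. ennreal (\<Prod>i\<in>UNIV. discrete_gamma_mass s (\<theta> i) (\<eta> i))) \<in> borel_measurable ?M"
      unfolding discrete_gamma_mass_def using c by measurable
    then show ?thesis
      unfolding 2 by (subst measurable_cong[OF emeasure_discrete_gamma_product_singleton[OF s nn]]) auto
  qed simp
qed (auto simp: sets_discrete_gamma_product)

section \<open>Beta and beta-binomial distributions\<close>

lemma nn_integral_beta_distribution:
  assumes "h \<in> borel_measurable borel"
  shows "(\<integral>\<^sup>+u. h u \<partial>beta_distribution a b) =
    (\<integral>\<^sup>+u. ennreal (u powr (a - 1) * (1 - u) powr (b - 1) / Beta a b) * h u * indicator {0..1} u \<partial>lborel)"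
proof -
  have m: "h \<in> borel_measurable (restrict_space lborel {0..1})"
    using assms by (intro measurable_restrict_space1) simp
  have m': "(\<lambda>u. ennreal (u powr (a - 1) * (1 - u) powr (b - 1) / Beta a b)) \<in> borel_measurable (restrict_space lborel {0..1})"
    by (intro measurable_restrict_space1) simp
  show ?thesis
    unfolding beta_distribution_def
    by (subst nn_integral_density[OF m' m], subst nn_integral_restrict_space) auto
qed

lemma Beta_real_pos: "0 < a \<Longrightarrow> 0 < b \<Longrightarrow> 0 < Beta a (b::real)"
  by (simp add: Beta_def)

lemma beta_distribution_moments:
  assumes a: "0 < a" and b: "0 < b"
  shows "(\<integral>\<^sup>+u. ennreal (u ^ k * (1 - u) ^ l) \<partial>beta_distribution a b)
    = ennreal (Beta (a + real k) (b + real l) / Beta a b)"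
proof -
  let ?f = "\<lambda>u. u powr (a + real k - 1) * (1 - u) powr (b + real l - 1)"
  \<comment> \<open>At \<open>u = 0\<close> both sides are 0 because \<open>0 powr x = 0\<close> for
    every exponent, so the endpoint needs no condition on \<open>c\<close>.\<close>
  have *: "u powr (c - 1) * u ^ n = u powr (c + real n - 1)" if "0 \<le> u" for u c :: real and n
    using that by (cases "u = 0") (simp_all add: powr_realpow[symmetric] powr_add[symmetric] algebra_simps)
  have "(\<integral>\<^sup>+u. ennreal (u ^ k * (1 - u) ^ l) \<partial>beta_distribution a b) =
    (\<integral>\<^sup>+u. ennreal (1 / Beta a b) * (ennreal (?f u) * indicator {0..1} u) \<partial>lborel)"
  proof (subst nn_integral_beta_distribution, simp, intro nn_integral_cong)
    fix u :: real
    show "ennreal (u powr (a - 1) * (1 - u) powr (b - 1) / Beta a b) * ennreal (u ^ k * (1 - u) ^ l) * indicator {0..1} u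
      = ennreal (1 / Beta a b) * (ennreal (?f u) * indicator {0..1} u)"
    proof (cases "u \<in> {0..1}")
      case True
      then have "?f u = (u powr (a - 1) * (1 - u) powr (b - 1)) * (u ^ k * (1 - u) ^ l)"
        by (simp add: *[symmetric] mult_ac)
      then show ?thesis
        using True Beta_real_pos[OF a b] by (simp add: ennreal_mult'[symmetric] mult_ac)
    qed simp
  qed
  also have "\<dots> = ennreal (1 / Beta a b) * (\<integral>\<^sup>+u. ennreal (?f u) * indicator {0..1} u \<partial>lborel)"
    by (rule nn_integral_cmult) measurable
  also have "(\<integral>\<^sup>+u. ennreal (?f u) * indicator {0..1} u \<partial>lborel) = ennreal (Beta (a + real k) (b + real l))"
    using a b by (intro nn_integral_has_integral_lebesgue' has_integral_Beta_real) auto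
  finally show ?thesis
    using Beta_real_pos[OF a b] by (simp add: ennreal_mult'[symmetric])
qed

lemma prob_space_beta_distribution:
  assumes "0 < a" "0 < b"
  shows "prob_space (beta_distribution a b)"
  using beta_distribution_moments[OF assms, of 0 0] Beta_real_pos[OF assms]
  by (intro prob_spaceI) simp

lemma space_beta_distribution [simp]: "space (beta_distribution a b) = {0..1}"
  by (simp add: beta_distribution_def space_restrict_space)

lemma sets_beta_distribution [measurable_cong]: "sets (beta_distribution a b) = sets (restrict_space borel {0..1})"
  by (simp add: beta_distribution_def sets_restrict_space)

lemma Beta_pochhammer:
  assumes a: "0 < a" and b: "0 < (b::real)"
  shows "Beta (a + real k) (b + real l) / Beta a b = pochhammer a k * pochhammer b l / pochhammer (a + b) (k + l)"
proof -
  have "z \<notin> \<int>\<^sub>\<le>\<^sub>0" if "0 < z" for z :: real using that by (auto elim!: nonpos_Ints_cases)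
  then have "pochhammer z n = Gamma (z + real n) / Gamma z" if "0 < z" for z :: real and n
    using that pochhammer_Gamma by blast
  moreover have "0 < Gamma (a + b)" "0 < Gamma a" "0 < Gamma b" "0 < Gamma (a + b + real (k + l))"
    using a b by (auto intro!: Gamma_real_pos)
  ultimately show ?thesis
    using a b by (simp add: Beta_def field_simps)
qed

text \<open>This is the Beta moment formula with Gamma quotients turned into rising factorials.
  Writing the total as \<open>k + l\<close> avoids truncated subtraction.\<close>

lemma beta_binomial_eq:
  assumes s: "0 < s"
  shows "beta_binomial s (k + l) k =
    real ((k + l) choose k) * pochhammer (2 * s) k * pochhammer (2 * s) l / pochhammer (4 * s) (k + l)"
proof -
  have s2: "0 < 2 * s" using s by simp
  have "(\<integral>u. u ^ k * (1 - u) ^ l \<partial>beta_distribution (2 * s) (2 * s)) =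
      Beta (2 * s + real k) (2 * s + real l) / Beta (2 * s) (2 * s)"
  proof (subst integral_eq_nn_integral)
    show "(\<lambda>u. u ^ k * (1 - u) ^ l) \<in> borel_measurable (beta_distribution (2 * s) (2 * s))"
      unfolding measurable_cong_sets[OF sets_beta_distribution refl]
      by (intro measurable_restrict_space1) simp
    show "AE u in beta_distribution (2 * s) (2 * s). 0 \<le> u ^ k * (1 - u) ^ l"
      by (rule AE_I2) simp
  qed (use Beta_real_pos s in \<open>simp add: beta_distribution_moments[OF s2 s2] less_imp_le\<close>)
  also have "\<dots> = pochhammer (2 * s) k * pochhammer (2 * s) l / pochhammer (4 * s) (k + l)"
    using Beta_pochhammer[OF s2 s2, of k l] by simp
  finally show ?thesis
    by (simp add: beta_binomial_def mult.assoc)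
qed

lemma beta_binomial_nonneg: "0 \<le> beta_binomial s n k"
  unfolding beta_binomial_def by (intro integral_nonneg_AE AE_I2) simp

lemma beta_binomial_eq_0: "n < k \<Longrightarrow> beta_binomial s n k = 0"
  by (simp add: beta_binomial_def)

text \<open>Vandermonde's identity for rising factorials, with 2s + 2s = 4s.\<close>

lemma sum_beta_binomial:
  assumes s: "0 < s"
  shows "(\<Sum>k\<le>n. beta_binomial s n k) = 1"
proof -
  have "(\<Sum>k\<le>n. beta_binomial s n k) =
    (\<Sum>k\<le>n. real (n choose k) * pochhammer (2 * s) k * pochhammer (2 * s) (n - k)) / pochhammer (4 * s) n"
    unfolding sum_divide_distrib
    by (intro sum.cong refl) (use beta_binomial_eq[OF s] in \<open>metis atMost_iff le_add_diff_inverse\<close>)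
  also have "\<dots> = 1"
    using pochhammer_binomial_sum[of "2 * s" "2 * s" n] pochhammer_pos[of "4 * s" n] s by simp
  finally show ?thesis .
qed

text \<open>The binomial theorem under the Beta integral. With X = x / (1 + x) and Y = y / (1 + y)
  the sum is, up to a factor, the weight that the convolution of two discrete Gamma laws gives to
  the total n.\<close>

lemma nn_integral_beta_binomial_generating:
  assumes s: "0 < s" and X: "0 \<le> X" and Y: "0 \<le> Y"
  shows "(\<integral>\<^sup>+v. ennreal ((v * X + (1 - v) * Y) ^ n) \<partial>beta_distribution (2 * s) (2 * s))
    = ennreal (\<Sum>k\<le>n. beta_binomial s n k * X ^ k * Y ^ (n - k))"
proof -
  have s2: "0 < 2 * s" using s by simp
  let ?B = "beta_distribution (2 * s) (2 * s)"
  have "(\<integral>\<^sup>+v. ennreal ((v * X + (1 - v) * Y) ^ n) \<partial>?B) =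
    (\<integral>\<^sup>+v. (\<Sum>k\<le>n. ennreal (real (n choose k) * X ^ k * Y ^ (n - k)) * ennreal (v ^ k * (1 - v) ^ (n - k))) \<partial>?B)"
  proof (rule nn_integral_cong)
    fix v assume "v \<in> space ?B"
    then have v: "0 \<le> v" "v \<le> 1" by auto
    have "(v * X + (1 - v) * Y) ^ n = (\<Sum>k\<le>n. (real (n choose k) * X ^ k * Y ^ (n - k)) * (v ^ k * (1 - v) ^ (n - k)))"
      unfolding binomial_ring by (intro sum.cong refl) (simp add: power_mult_distrib mult_ac)
    then show "ennreal ((v * X + (1 - v) * Y) ^ n) =
      (\<Sum>k\<le>n. ennreal (real (n choose k) * X ^ k * Y ^ (n - k)) * ennreal (v ^ k * (1 - v) ^ (n - k)))"
      using v X Y by (simp add: ennreal_mult''[symmetric] sum_ennreal)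
  qed
  also have "\<dots> = (\<Sum>k\<le>n. ennreal (real (n choose k) * X ^ k * Y ^ (n - k)) * (\<integral>\<^sup>+v. ennreal (v ^ k * (1 - v) ^ (n - k)) \<partial>?B))"
  proof -
    have "(\<lambda>v. ennreal (v ^ k * (1 - v) ^ (n - k))) \<in> borel_measurable ?B" for k
      unfolding measurable_cong_sets[OF sets_beta_distribution refl]
      by (intro measurable_restrict_space1) simp
    then show ?thesis
      by (subst nn_integral_sum) (auto simp: nn_integral_cmult)
  qed
  also have "\<dots> = (\<Sum>k\<le>n. ennreal (beta_binomial s n k * X ^ k * Y ^ (n - k)))"
  proof (rule sum.cong[OF refl])
    fix k assume "k \<in> {..n}"
    then have n: "n = k + (n - k)" by simp
    have "real (n choose k) * X ^ k * Y ^ (n - k) * (Beta (2 * s + real k) (2 * s + real (n - k)) / Beta (2 * s) (2 * s))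
      = beta_binomial s n k * X ^ k * Y ^ (n - k)"
      using beta_binomial_eq[OF s, of k "n - k"] Beta_pochhammer[OF s2 s2, of k "n - k"] n[symmetric]
      by (simp add: mult_ac)
    then show "ennreal (real (n choose k) * X ^ k * Y ^ (n - k)) * (\<integral>\<^sup>+v. ennreal (v ^ k * (1 - v) ^ (n - k)) \<partial>?B)
      = ennreal (beta_binomial s n k * X ^ k * Y ^ (n - k))"
      using X Y by (simp add: beta_distribution_moments[OF s2 s2] ennreal_mult'[symmetric])
  qed
  also have "\<dots> = ennreal (\<Sum>k\<le>n. beta_binomial s n k * X ^ k * Y ^ (n - k))"
    using X Y by (intro sum_ennreal) (auto intro!: mult_nonneg_nonneg beta_binomial_nonneg)
  finally show ?thesis .
qed

text \<open>
  The change of variables is \<open>v = u (1 + x) / (1 + z u)\<close>; it turns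
  \<open>v x / (1 + x) + (1 - v) y / (1 + y)\<close> into \<open>z u / (1 + z u)\<close>.
\<close>

lemma nn_integral_beta_substitution:
  assumes s: "0 < s" and x: "0 \<le> x" and y: "0 \<le> y"
  defines "z \<equiv> \<lambda>u. x * u + y * (1 - u)"
  shows "(\<integral>\<^sup>+u. ennreal ((z u / (1 + z u)) ^ n * (1 / (1 + z u)) powr (4 * s)) \<partial>beta_distribution (2 * s) (2 * s))
    = ennreal ((1 / (1 + x) * (1 / (1 + y))) powr (2 * s)) *
      (\<integral>\<^sup>+v. ennreal ((v * (x / (1 + x)) + (1 - v) * (y / (1 + y))) ^ n) \<partial>beta_distribution (2 * s) (2 * s))"
    (is "?L = ennreal ?C * ?R")
proof -
  define g where "g u = u * (1 + x) / (1 + z u)" for u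
  \<comment> \<open>Besides being the derivative of \<open>g\<close>, this function satisfies
    \<open>g u * (1 - g u) = u * (1 - u) * g' u\<close>. This is why the symmetric Beta density
    reproduces itself under the substitution.\<close>
  define g' where "g' u = (1 + x) * (1 + y) / (1 + z u)\<^sup>2" for u
  define f where "f v = v powr (2 * s - 1) * (1 - v) powr (2 * s - 1) / Beta (2 * s) (2 * s) *
    (v * (x / (1 + x)) + (1 - v) * (y / (1 + y))) ^ n" for v
  have z: "0 \<le> z u" if "u \<in> {0..1}" for u
    using that x y by (auto simp: z_def)
  have B: "0 < Beta (2 * s) (2 * s)" using s by (intro Beta_real_pos) auto
  have g01: "g 0 = 0" "g 1 = 1" using x by (auto simp: g_def z_def)
  have "?R = (\<integral>\<^sup>+v. ennreal (f v) * indicator {g 0..g 1} v \<partial>lborel)"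
  proof (subst nn_integral_beta_distribution, simp, intro nn_integral_cong)
    fix v :: real
    show "ennreal (v powr (2 * s - 1) * (1 - v) powr (2 * s - 1) / Beta (2 * s) (2 * s)) *
          ennreal ((v * (x / (1 + x)) + (1 - v) * (y / (1 + y))) ^ n) * indicator {0..1} v =
          ennreal (f v) * indicator {g 0..g 1} v"
      using B by (auto simp: f_def g01 ennreal_mult'[symmetric] indicator_def)
  qed
  also have "\<dots> = (\<integral>\<^sup>+u. ennreal (f (g u) * g' u) * indicator {0..1} u \<partial>lborel)"
    unfolding nn_integral_set_ennreal
  proof (rule nn_integral_substitution)
    show "set_borel_measurable borel {g 0..g 1} f"
      unfolding f_def [abs_def] set_borel_measurable_def by measurable
    show "(g has_real_derivative g' u) (at u)" if "u \<in> {0..1}" for u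
    proof -
      have "1 + (x * u + y * (1 - u)) \<noteq> 0" using z[OF that] by (auto simp: z_def)
      then show ?thesis
        unfolding g_def [abs_def] g'_def z_def
        by (auto intro!: derivative_eq_intros simp: power2_eq_square field_simps)
    qed
    show "continuous_on {0..1} g'"
      unfolding g'_def [abs_def] using z by (auto intro!: continuous_intros simp: z_def) force
    show "0 \<le> g' u" if "u \<in> {0..1}" for u
      using x y by (simp add: g'_def)
  qed simp
  finally have R: "?R = (\<integral>\<^sup>+u. ennreal (f (g u) * g' u) * indicator {0..1} u \<partial>lborel)" .
  have pw: "?C * (f (g u) * g' u) = u powr (2 * s - 1) * (1 - u) powr (2 * s - 1) / Beta (2 * s) (2 * s) *
    ((z u / (1 + z u)) ^ n * (1 / (1 + z u)) powr (4 * s))" if u: "u \<in> {0..1}" for u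
  proof -
    have p: "0 < 1 + z u" "0 < 1 + x" "0 < 1 + y" using z[OF u] x y by auto
    have z_alt: "z u = x * u + y * (1 - u)" by (simp add: z_def)
    have g1: "1 - g u = (1 - u) * (1 + y) / (1 + z u)"
      using p by (simp add: g_def z_alt field_simps)
    have "g u * (x / (1 + x)) = u * x / (1 + z u)" "(1 - g u) * (y / (1 + y)) = (1 - u) * y / (1 + z u)"
      unfolding g1 using p by (auto simp: g_def)
    then have "g u * (x / (1 + x)) + (1 - g u) * (y / (1 + y)) = z u / (1 + z u)"
      by (simp add: add_divide_distrib[symmetric] z_alt mult.commute)
    moreover have "g u powr (2 * s - 1) * (1 - g u) powr (2 * s - 1) =
      u powr (2 * s - 1) * (1 - u) powr (2 * s - 1) * g' u powr (2 * s - 1)"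
    proof -
      have "g u * (1 - g u) = (u * (1 - u)) * g' u"
        unfolding g1 by (simp add: g_def g'_def power2_eq_square)
      then have "(g u * (1 - g u)) powr (2 * s - 1) = ((u * (1 - u)) * g' u) powr (2 * s - 1)" by simp
      moreover have "0 \<le> g u" "0 \<le> 1 - g u" "0 \<le> g' u"
        unfolding g1 using p u by (auto simp: g_def g'_def)
      ultimately show ?thesis using u by (simp add: powr_mult)
    qed
    \<comment> \<open>The density contributes the exponent 2s - 1 of \<open>g' u\<close> and the
      Jacobian one more. The factor \<open>?C\<close> cancels the numerator (1 + x)(1 + y), and the
      square in the denominator doubles 2s to 4s.\<close>
    moreover have "?C * (g' u powr (2 * s - 1) * g' u) = (1 / (1 + z u)) powr (4 * s)"
    proof -
      have pos: "0 < g' u" using p by (simp add: g'_def)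
      then have "g' u powr (2 * s - 1) * g' u = g' u powr (2 * s)"
        by (simp add: powr_diff)
      then have "?C * (g' u powr (2 * s - 1) * g' u) = ?C * g' u powr (2 * s)"
        by (simp only:)
      also have "\<dots> = (1 / (1 + x) * (1 / (1 + y)) * g' u) powr (2 * s)"
        by (rule powr_mult[symmetric])
      also have "1 / (1 + x) * (1 / (1 + y)) * g' u = (1 / (1 + z u))\<^sup>2"
        using p by (simp add: g'_def power_divide)
      also have "\<dots> powr (2 * s) = (1 / (1 + z u)) powr (4 * s)"
        unfolding power2_eq_square powr_mult powr_add[symmetric] by simp
      finally show ?thesis .
    qed
    ultimately show ?thesis
      by (simp add: f_def mult_ac)
  qed
  have "?L = (\<integral>\<^sup>+u. ennreal ?C * (ennreal (f (g u) * g' u) * indicator {0..1} u) \<partial>lborel)"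
  proof (subst nn_integral_beta_distribution)
    show "(\<lambda>u. ennreal ((z u / (1 + z u)) ^ n * (1 / (1 + z u)) powr (4 * s))) \<in> borel_measurable borel"
      unfolding z_def by measurable
  next
    show "(\<integral>\<^sup>+u. ennreal (u powr (2 * s - 1) * (1 - u) powr (2 * s - 1) / Beta (2 * s) (2 * s)) *
        ennreal ((z u / (1 + z u)) ^ n * (1 / (1 + z u)) powr (4 * s)) * indicator {0..1} u \<partial>lborel) =
      (\<integral>\<^sup>+u. ennreal ?C * (ennreal (f (g u) * g' u) * indicator {0..1} u) \<partial>lborel)"
    proof (rule nn_integral_cong)
      fix u :: real
      show "ennreal (u powr (2 * s - 1) * (1 - u) powr (2 * s - 1) / Beta (2 * s) (2 * s)) *
        ennreal ((z u / (1 + z u)) ^ n * (1 / (1 + z u)) powr (4 * s)) * indicator {0..1} u =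
        ennreal ?C * (ennreal (f (g u) * g' u) * indicator {0..1} u)"
        using B pw[of u] by (cases "u \<in> {0..1}") (simp_all add: ennreal_mult'[symmetric])
    qed
  qed
  also have "\<dots> = ennreal ?C * ?R"
    unfolding R by (rule nn_integral_cmult) (unfold f_def g_def g'_def z_def, measurable)
  finally show ?thesis .
qed

text \<open>Separates the split of the total from the rest: for x = y everything except the
  beta-binomial factor depends on \<open>k + l\<close> only, so the split given the total is
  beta-binomial.\<close>

lemma discrete_gamma_mass_mult:
  assumes s: "0 < s" and x: "0 \<le> x" and y: "0 \<le> y"
  shows "discrete_gamma_mass s x k * discrete_gamma_mass s y l =
    pochhammer (4 * s) (k + l) / fact (k + l) * beta_binomial s (k + l) k *
    (x / (1 + x)) ^ k * (y / (1 + y)) ^ l * (1 / (1 + x) * (1 / (1 + y))) powr (2 * s)"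
proof -
  have "pochhammer (4 * s) (k + l) \<noteq> 0" using pochhammer_pos[of "4 * s"] s by (simp add: less_imp_neq[symmetric])
  moreover have "real ((k + l) choose k) = fact (k + l) / (fact k * fact l)"
    by (simp add: binomial_fact)
  ultimately have "pochhammer (4 * s) (k + l) / fact (k + l) * beta_binomial s (k + l) k =
    pochhammer (2 * s) k / fact k * (pochhammer (2 * s) l / fact l)"
    unfolding beta_binomial_eq[OF s] by simp
  moreover have "(1 / (1 + x) * (1 / (1 + y))) powr (2 * s) = (1 / (1 + x)) powr (2 * s) * (1 / (1 + y)) powr (2 * s)"
    using x y by (intro powr_mult)
  ultimately show ?thesis
    by (simp add: discrete_gamma_mass_def mult_ac)
qed

text \<open>On the left both endpoints carry the parameter \<open>z u\<close>, so the beta-binomial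
  factor does not depend on u and leaves the integral. What remains is the law of the total, which
  the change of variables identifies with the convolution on the right.\<close>

lemma discrete_gamma_edge_intertwining:
  assumes s: "0 < s" and x: "0 \<le> x" and y: "0 \<le> y"
  defines "z \<equiv> \<lambda>u. x * u + y * (1 - u)"
  shows "(\<integral>\<^sup>+u. ennreal (discrete_gamma_mass s (z u) k * discrete_gamma_mass s (z u) l) \<partial>beta_distribution (2 * s) (2 * s))
    = ennreal ((\<Sum>a\<le>k + l. discrete_gamma_mass s x a * discrete_gamma_mass s y (k + l - a)) * beta_binomial s (k + l) k)"
proof -
  define n where "n = k + l"
  \<comment> \<open>The coefficient of the negative binomial law of shape 4s at the total n.\<close>
  define \<kappa> where "\<kappa> = pochhammer (4 * s) n / fact n"
  have \<kappa>: "0 \<le> \<kappa>" using s by (simp add: \<kappa>_def pochhammer_nonneg)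
  let ?B = "beta_distribution (2 * s) (2 * s)"
  let ?h = "\<lambda>u. (z u / (1 + z u)) ^ n * (1 / (1 + z u)) powr (4 * s)"
  let ?C = "(1 / (1 + x) * (1 / (1 + y))) powr (2 * s)"
  let ?S = "\<Sum>a\<le>n. beta_binomial s n a * (x / (1 + x)) ^ a * (y / (1 + y)) ^ (n - a)"
  have S: "0 \<le> ?S" using x y by (intro sum_nonneg) (auto intro!: mult_nonneg_nonneg beta_binomial_nonneg)
  have "(\<integral>\<^sup>+u. ennreal (discrete_gamma_mass s (z u) k * discrete_gamma_mass s (z u) l) \<partial>?B)
    = (\<integral>\<^sup>+u. ennreal (\<kappa> * beta_binomial s n k) * ennreal (?h u) \<partial>?B)"
  proof (rule nn_integral_cong)
    fix u assume "u \<in> space ?B"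
    then have z: "0 \<le> z u" using x y by (auto simp: z_def)
    have "(1 / (1 + z u) * (1 / (1 + z u))) powr (2 * s) = (1 / (1 + z u)) powr (4 * s)"
      using z by (subst powr_mult) (auto simp: powr_add[symmetric])
    then have "discrete_gamma_mass s (z u) k * discrete_gamma_mass s (z u) l = \<kappa> * beta_binomial s n k * ?h u"
      unfolding discrete_gamma_mass_mult[OF s z z] n_def \<kappa>_def by (simp add: power_add)
    then show "ennreal (discrete_gamma_mass s (z u) k * discrete_gamma_mass s (z u) l) =
      ennreal (\<kappa> * beta_binomial s n k) * ennreal (?h u)"
      using \<kappa> z by (simp add: ennreal_mult'[symmetric] beta_binomial_nonneg)
  qed
  also have "\<dots> = ennreal (\<kappa> * beta_binomial s n k) * (\<integral>\<^sup>+u. ennreal (?h u) \<partial>?B)"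
  proof (rule nn_integral_cmult)
    show "(\<lambda>u. ennreal (?h u)) \<in> borel_measurable ?B"
      unfolding measurable_cong_sets[OF sets_beta_distribution refl] z_def
      by (intro measurable_restrict_space1) measurable
  qed
  also have "(\<integral>\<^sup>+u. ennreal (?h u) \<partial>?B) = ennreal (?C * ?S)"
    using x y S unfolding z_def nn_integral_beta_substitution[OF s x y]
    by (subst nn_integral_beta_binomial_generating[OF s]) (simp_all add: ennreal_mult'[symmetric])
  also have "ennreal (\<kappa> * beta_binomial s n k) * ennreal (?C * ?S) = ennreal (\<kappa> * beta_binomial s n k * (?C * ?S))"
    using S by (intro ennreal_mult''[symmetric]) simp
  also have "\<kappa> * beta_binomial s n k * (?C * ?S) =
    (\<Sum>a\<le>n. discrete_gamma_mass s x a * discrete_gamma_mass s y (n - a)) * beta_binomial s n k"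
  proof -
    have "discrete_gamma_mass s x a * discrete_gamma_mass s y (n - a) =
      \<kappa> * ?C * (beta_binomial s n a * (x / (1 + x)) ^ a * (y / (1 + y)) ^ (n - a))" if "a \<in> {..n}" for a
      using that by (subst discrete_gamma_mass_mult[OF s x y]) (simp add: \<kappa>_def mult_ac)
    then have "(\<Sum>a\<le>n. discrete_gamma_mass s x a * discrete_gamma_mass s y (n - a)) = \<kappa> * ?C * ?S"
      unfolding sum_distrib_left by (rule sum.cong[OF refl])
    then show ?thesis by (simp add: mult_ac)
  qed
  finally show ?thesis by (simp add: n_def)
qed

section \<open>Kernels on edges\<close>

text \<open>
  A diagonal pair stands for doing nothing. Its weight \<open>1\<close> keeps the total weight positive even if
  \<open>p\<close> vanishes off the diagonal, e.g. on a single vertex.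
\<close>

definition edge_weight :: "('v \<Rightarrow> 'v \<Rightarrow> real) \<Rightarrow> 'v \<times> 'v \<Rightarrow> real" where
  "edge_weight p = (\<lambda>(i, j). if i = j then 1 else p i j)"

definition total_weight :: "('v::finite \<Rightarrow> 'v \<Rightarrow> real) \<Rightarrow> real" where
  "total_weight p = (\<Sum>e\<in>UNIV. edge_weight p e)"

definition edge_pmf :: "('v::finite \<Rightarrow> 'v \<Rightarrow> real) \<Rightarrow> ('v \<times> 'v) pmf" where
  "edge_pmf p = embed_pmf (\<lambda>e. edge_weight p e / total_weight p)"

definition edge_kernel :: "'a measure \<Rightarrow> ('v \<Rightarrow> 'v \<Rightarrow> 'a \<Rightarrow> 'a measure) \<Rightarrow> 'v \<times> 'v \<Rightarrow> 'a \<Rightarrow> 'a measure" where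
  "edge_kernel E k = (\<lambda>(i, j). if i = j then return E else k i j)"

definition edge_mixture ::
  "'a measure \<Rightarrow> ('v::finite \<Rightarrow> 'v \<Rightarrow> real) \<Rightarrow> ('v \<Rightarrow> 'v \<Rightarrow> 'a \<Rightarrow> 'a measure) \<Rightarrow> 'a \<Rightarrow> 'a measure" where
  "edge_mixture E p k x = measure_pmf (edge_pmf p) \<bind> (\<lambda>e. edge_kernel E k e x)"

lemma measurable_edge_kernel:
  assumes "\<And>i j. k i j \<in> E \<rightarrow>\<^sub>M prob_algebra E"
  shows "edge_kernel E k e \<in> E \<rightarrow>\<^sub>M prob_algebra E"
  using assms by (cases e) (simp add: edge_kernel_def)

lemma measurable_edge_mixture:
  assumes "\<And>i j. k i j \<in> E \<rightarrow>\<^sub>M prob_algebra E"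
  shows "edge_mixture E p k \<in> E \<rightarrow>\<^sub>M prob_algebra E"
  unfolding edge_mixture_def [abs_def]
  by (intro measurable_pmf_mixture measurable_edge_kernel assms)

context
  fixes p :: "'v::finite \<Rightarrow> 'v \<Rightarrow> real"
  assumes p: "\<And>i j. 0 \<le> p i j"
begin

lemma edge_weight_nonneg: "0 \<le> edge_weight p e"
  using p by (auto simp: edge_weight_def split: prod.split)

lemma total_weight_pos: "0 < total_weight p"
proof -
  have "0 < edge_weight p (i, i)" for i by (simp add: edge_weight_def)
  then show ?thesis
    unfolding total_weight_def by (intro sum_pos2[where i="(undefined, undefined)"]) (auto simp: edge_weight_nonneg)
qed

lemma pmf_edge_pmf: "pmf (edge_pmf p) e = edge_weight p e / total_weight p"
  unfolding edge_pmf_def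
proof (rule pmf_embed_pmf)
  show "0 \<le> edge_weight p e / total_weight p" for e
    using edge_weight_nonneg[of e] total_weight_pos by simp
  then have "(\<integral>\<^sup>+e. ennreal (edge_weight p e / total_weight p) \<partial>count_space UNIV) =
      ennreal (\<Sum>e\<in>UNIV. edge_weight p e / total_weight p)"
    by (simp add: nn_integral_count_space_finite sum_ennreal)
  also have "(\<Sum>e\<in>UNIV. edge_weight p e / total_weight p) = 1"
    using total_weight_pos by (simp add: sum_divide_distrib[symmetric] total_weight_def[symmetric])
  finally show "(\<integral>\<^sup>+e. ennreal (edge_weight p e / total_weight p) \<partial>count_space UNIV) = 1" by simp
qed

text \<open>The normalization of the edge probabilities cancels against the rate, and a diagonal
  pair contributes \<open>f x - f x\<close>. Its artificial weight thus changes the jump rate but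
  not the generator.\<close>

lemma edge_mixture_generator:
  fixes f :: "'a \<Rightarrow> real"
  assumes k: "\<And>i j. k i j \<in> E \<rightarrow>\<^sub>M prob_algebra E"
    and f: "f \<in> borel_measurable E" "bounded (f ` space E)" and x: "x \<in> space E"
  shows "total_weight p * ((\<integral>y. f y \<partial>edge_mixture E p k x) - f x) =
    (\<Sum>i\<in>UNIV. \<Sum>j\<in>UNIV - {i}. p i j * ((\<integral>y. f y \<partial>k i j x) - f x))"
proof -
  obtain B where B: "\<And>y. y \<in> space E \<Longrightarrow> \<bar>f y\<bar> \<le> B"
    using f(2) by (auto simp: bounded_iff)
  let ?I = "\<lambda>e. \<integral>y. f y \<partial>edge_kernel E k e x"
  have "(\<integral>y. f y \<partial>edge_mixture E p k x) = (\<integral>e. ?I e \<partial>edge_pmf p)"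
    unfolding edge_mixture_def
    by (rule integral_bind_kernel[where M="count_space UNIV", OF _ _ f(1) B])
       (auto simp: space_prob_algebra prob_space_measure_pmf kernel_space[OF measurable_edge_kernel[OF k] x])
  also have "\<dots> = (\<Sum>e\<in>UNIV. ?I e * pmf (edge_pmf p) e)"
    by (rule integral_measure_pmf_real) auto
  also have "\<dots> = (\<Sum>e\<in>UNIV. edge_weight p e * ?I e) / total_weight p"
    by (simp add: pmf_edge_pmf sum_divide_distrib mult.commute)
  finally have "total_weight p * ((\<integral>y. f y \<partial>edge_mixture E p k x) - f x) =
      (\<Sum>e\<in>UNIV. edge_weight p e * ?I e) - (\<Sum>e\<in>UNIV. edge_weight p e) * f x"
    using total_weight_pos by (simp add: right_diff_distrib total_weight_def[symmetric])
  also have "\<dots> = (\<Sum>e\<in>UNIV. edge_weight p e * (?I e - f x))"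
    by (simp add: sum_subtractf sum_distrib_right right_diff_distrib)
  also have "\<dots> = (\<Sum>i\<in>UNIV. \<Sum>j\<in>UNIV. edge_weight p (i, j) * (?I (i, j) - f x))"
    by (simp add: sum.cartesian_product split_beta)
  also have "\<dots> = (\<Sum>i\<in>UNIV. \<Sum>j\<in>UNIV - {i}. p i j * ((\<integral>y. f y \<partial>k i j x) - f x))"
  proof (rule sum.cong[OF refl])
    fix i
    have "(\<Sum>j\<in>UNIV. edge_weight p (i, j) * (?I (i, j) - f x)) =
        edge_weight p (i, i) * (?I (i, i) - f x) + (\<Sum>j\<in>UNIV - {i}. edge_weight p (i, j) * (?I (i, j) - f x))"
      by (rule sum.remove) auto
    also have "?I (i, i) = f x"
      using f x by (simp add: edge_kernel_def integral_return)
    finally show "(\<Sum>j\<in>UNIV. edge_weight p (i, j) * (?I (i, j) - f x)) =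
        (\<Sum>j\<in>UNIV - {i}. p i j * ((\<integral>y. f y \<partial>k i j x) - f x))"
      by (auto simp: edge_weight_def edge_kernel_def intro!: sum.cong)
  qed
  finally show ?thesis .
qed

end

section \<open>The redistribution kernel of the discrete model\<close>

definition beta_binomial_pmf :: "real \<Rightarrow> nat \<Rightarrow> nat pmf" where
  "beta_binomial_pmf s n = embed_pmf (beta_binomial s n)"

lemma pmf_beta_binomial_pmf:
  assumes s: "0 < s"
  shows "pmf (beta_binomial_pmf s n) k = beta_binomial s n k"
  unfolding beta_binomial_pmf_def
proof (rule pmf_embed_pmf[OF beta_binomial_nonneg])
  have "(\<integral>\<^sup>+k. ennreal (beta_binomial s n k) \<partial>count_space UNIV) = (\<Sum>k\<le>n. ennreal (beta_binomial s n k))"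
    by (rule nn_integral_count_space') (auto simp: beta_binomial_eq_0)
  also have "\<dots> = 1"
    by (simp add: sum_ennreal beta_binomial_nonneg sum_beta_binomial[OF s])
  finally show "(\<integral>\<^sup>+k. ennreal (beta_binomial s n k) \<partial>count_space UNIV) = 1" .
qed

definition kmp_edge_kernel :: "real \<Rightarrow> 'v \<Rightarrow> 'v \<Rightarrow> ('v \<Rightarrow> nat) \<Rightarrow> ('v \<Rightarrow> nat) measure" where
  "kmp_edge_kernel s i j \<eta> =
     measure_pmf (map_pmf (\<lambda>k. \<eta>(i := k, j := \<eta> i + \<eta> j - k)) (beta_binomial_pmf s (\<eta> i + \<eta> j)))"

lemma measurable_kmp_edge_kernel:
  "kmp_edge_kernel s i j \<in> config_space \<rightarrow>\<^sub>M prob_algebra (config_space :: ('v::finite \<Rightarrow> nat) measure)"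
  by (auto simp: config_space_eq kmp_edge_kernel_def space_prob_algebra prob_space_measure_pmf)

lemma integral_kmp_edge_kernel:
  fixes f :: "('v::finite \<Rightarrow> nat) \<Rightarrow> real"
  assumes s: "0 < s"
  shows "(\<integral>\<xi>. f \<xi> \<partial>kmp_edge_kernel s i j \<eta>) - f \<eta> = kmp_edge_gen s i j f \<eta>"
proof -
  have "(\<integral>\<xi>. f \<xi> \<partial>kmp_edge_kernel s i j \<eta>) =
    (\<Sum>k\<le>\<eta> i + \<eta> j. f (\<eta>(i := k, j := \<eta> i + \<eta> j - k)) * beta_binomial s (\<eta> i + \<eta> j) k)"
    unfolding kmp_edge_kernel_def integral_map_pmf
    by (subst integral_measure_pmf_real[where A="{..\<eta> i + \<eta> j}"])
       (auto simp: set_pmf_iff pmf_beta_binomial_pmf[OF s] intro: leI dest: beta_binomial_eq_0)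
  moreover have "f \<eta> = (\<Sum>k\<le>\<eta> i + \<eta> j. f \<eta> * beta_binomial s (\<eta> i + \<eta> j) k)"
    by (simp add: sum_distrib_left[symmetric] sum_beta_binomial[OF s])
  ultimately show ?thesis
    by (simp add: kmp_edge_gen_def right_diff_distrib sum_subtractf mult.commute)
qed

text \<open>The kernel read backwards: \<eta> can be reached exactly from the configurations that
  agree with it off the edge and have the same total on it, up to transitions of probability zero.
  The probability is the same from each of them, so it can be pulled out of an integral over
  \<xi>.\<close>

lemma emeasure_kmp_edge_kernel_singleton:
  assumes s: "0 < s" and ij: "i \<noteq> j"
  shows "emeasure (kmp_edge_kernel s i j \<xi>) {\<eta>} =
    (if \<xi> \<in> (\<lambda>a. \<eta>(i := a, j := \<eta> i + \<eta> j - a)) ` {..\<eta> i + \<eta> j}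
     then ennreal (beta_binomial s (\<eta> i + \<eta> j) (\<eta> i)) else 0)"
proof -
  define n where "n = \<xi> i + \<xi> j"
  define h where "h k = \<xi>(i := k, j := n - k)" for k
  have bb: "k \<le> n" if "beta_binomial s n k \<noteq> 0" for k
    using that by (rule contrapos_np) (simp add: beta_binomial_eq_0)
  have "emeasure (kmp_edge_kernel s i j \<xi>) {\<eta>} = emeasure (beta_binomial_pmf s n) (h -` {\<eta>})"
    by (simp add: kmp_edge_kernel_def h_def [abs_def] n_def)
  \<comment> \<open>The restriction to \<open>k \<le> n\<close> only discards a null set, but it is
    essential for the set identity below: for larger \<open>k\<close> the truncated
    \<open>n - k\<close> is 0, and \<open>h k\<close> could equal \<eta> although the totals
    differ.\<close>
  also have "\<dots> = emeasure (beta_binomial_pmf s n) {k. k \<le> n \<and> h k = \<eta>}"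
    by (rule emeasure_eq_AE)
       (auto simp: AE_measure_pmf_iff set_pmf_iff pmf_beta_binomial_pmf[OF s] dest: bb)
  also have "{k. k \<le> n \<and> h k = \<eta>} =
    (if \<xi> \<in> (\<lambda>a. \<eta>(i := a, j := \<eta> i + \<eta> j - a)) ` {..\<eta> i + \<eta> j} then {\<eta> i} else {})"
  proof (cases "\<xi> \<in> (\<lambda>a. \<eta>(i := a, j := \<eta> i + \<eta> j - a)) ` {..\<eta> i + \<eta> j}")
    case True
    then show ?thesis using ij by (auto simp: h_def n_def fun_eq_iff)
  next
    case False
    have "\<not> (k \<le> n \<and> h k = \<eta>)" for k
    proof
      assume k: "k \<le> n \<and> h k = \<eta>"
      then have \<eta>: "\<eta> = h k" and sum: "\<eta> i + \<eta> j = n" using ij by (auto simp: h_def)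
      have 1: "\<xi> = \<eta>(i := \<xi> i, j := \<eta> i + \<eta> j - \<xi> i)"
      proof
        show "\<xi> l = (\<eta>(i := \<xi> i, j := \<eta> i + \<eta> j - \<xi> i)) l" for l
          unfolding sum unfolding \<eta> using ij by (simp add: h_def n_def)
      qed
      have 2: "\<xi> i \<in> {..\<eta> i + \<eta> j}"
        unfolding sum by (simp add: n_def)
      from False image_eqI[where f="\<lambda>a. \<eta>(i := a, j := \<eta> i + \<eta> j - a)", OF 1 2]
      show False by (rule notE)
    qed
    then show ?thesis using False by auto
  qed
  also have "emeasure (beta_binomial_pmf s n) \<dots> =
    (if \<xi> \<in> (\<lambda>a. \<eta>(i := a, j := \<eta> i + \<eta> j - a)) ` {..\<eta> i + \<eta> j}
     then ennreal (beta_binomial s (\<eta> i + \<eta> j) (\<eta> i)) else 0)"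
    using ij by (auto simp: emeasure_pmf_single pmf_beta_binomial_pmf[OF s] n_def)
  finally show ?thesis .
qed

section \<open>The averaging kernel of the hidden model\<close>

definition hidden_edge_kernel :: "('v \<Rightarrow> real) measure \<Rightarrow> real \<Rightarrow> 'v \<Rightarrow> 'v \<Rightarrow> ('v \<Rightarrow> real) \<Rightarrow> ('v \<Rightarrow> real) measure" where
  "hidden_edge_kernel M s i j \<theta> = distr (beta_distribution (2 * s) (2 * s)) M
     (\<lambda>u. \<theta>(i := \<theta> i * u + \<theta> j * (1 - u), j := \<theta> i * u + \<theta> j * (1 - u)))"

context
  fixes A :: "real set" and M :: "('v::finite \<Rightarrow> real) measure"
  assumes A: "convex A" "A \<subseteq> {0..}" and M: "M = PiM UNIV (\<lambda>_. restrict_space borel A)"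
begin

lemma space_hidden: "space M = {\<theta>. \<forall>i. \<theta> i \<in> A}"
  by (auto simp: M space_PiM space_restrict_space PiE_UNIV_domain)

lemma measurable_hidden_component: "(\<lambda>\<theta>. \<theta> i) \<in> borel_measurable M"
  unfolding M
  by (rule measurable_compose[OF measurable_component_singleton[OF UNIV_I]])
     (rule measurable_restrict_space1, simp)

text \<open>The new common value is a convex combination of \<theta> i and \<theta> j, so convexity
  of \<open>A\<close> keeps the update inside the state space; this is where u must lie in
  [0,1].\<close>

lemma measurable_hidden_edge_update:
  "(\<lambda>(\<theta>, u). \<theta>(i := \<theta> i * u + \<theta> j * (1 - u), j := \<theta> i * u + \<theta> j * (1 - u)))
    \<in> M \<Otimes>\<^sub>M restrict_space borel {0..1} \<rightarrow>\<^sub>M M"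
  (is "?h \<in> ?N \<rightarrow>\<^sub>M _")
proof -
  have c: "(\<lambda>x. fst x l) \<in> borel_measurable ?N" for l
    by (rule measurable_compose[OF measurable_fst measurable_hidden_component])
  have u: "snd \<in> borel_measurable ?N"
    by (rule measurable_compose[OF measurable_snd]) (rule measurable_restrict_space1, simp)
  have mem: "?h x l \<in> A" if "x \<in> space ?N" for x l
  proof -
    obtain \<theta> u where x: "x = (\<theta>, u)" "\<And>l. \<theta> l \<in> A" "0 \<le> u" "u \<le> 1"
      using \<open>x \<in> space ?N\<close> by (auto simp: space_pair_measure space_restrict_space space_hidden)
    then show ?thesis
      using convexD[OF A(1), of "\<theta> i" "\<theta> j" u "1 - u"] by (simp add: mult.commute)
  qed
  have "(\<lambda>x l. ?h x l) \<in> ?N \<rightarrow>\<^sub>M PiM UNIV (\<lambda>_. restrict_space borel A)"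
  proof (rule measurable_PiM_single')
    fix l
    have "(\<lambda>x. ?h x l) \<in> borel_measurable ?N"
      using c u by (simp add: split_beta fun_upd_def)
    then show "(\<lambda>x. ?h x l) \<in> ?N \<rightarrow>\<^sub>M restrict_space borel A"
      using mem by (intro measurable_restrict_space2) auto
  next
    show "(\<lambda>x l. ?h x l) \<in> space ?N \<rightarrow> (\<Pi>\<^sub>E l\<in>UNIV. space (restrict_space borel A))"
      using mem by (simp add: PiE_UNIV_domain space_restrict_space Pi_iff del: split_paired_All)
  qed
  then show ?thesis by (simp add: M)
qed

lemma beta_distribution_in_prob_algebra:
  assumes "0 < s"
  shows "beta_distribution (2 * s) (2 * s) \<in> space (prob_algebra (restrict_space borel {0..1}))"
  using assms by (simp add: space_prob_algebra sets_beta_distribution prob_space_beta_distribution)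

lemma measurable_hidden_edge_kernel:
  assumes "0 < s"
  shows "hidden_edge_kernel M s i j \<in> M \<rightarrow>\<^sub>M prob_algebra M"
  unfolding hidden_edge_kernel_def [abs_def]
  by (rule measurable_distr_prob_space2[where M="restrict_space borel {0..1}", OF measurable_const measurable_hidden_edge_update])
     (rule beta_distribution_in_prob_algebra[OF assms])

lemma measurable_hidden_edge_update_fixed:
  assumes "\<theta> \<in> space M"
  shows "(\<lambda>u. \<theta>(i := \<theta> i * u + \<theta> j * (1 - u), j := \<theta> i * u + \<theta> j * (1 - u)))
    \<in> beta_distribution a b \<rightarrow>\<^sub>M M"
proof -
  have "(\<lambda>u. (\<theta>, u)) \<in> beta_distribution a b \<rightarrow>\<^sub>M M \<Otimes>\<^sub>M restrict_space borel {0..1}"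
    using assms unfolding measurable_cong_sets[OF sets_beta_distribution refl] by measurable
  from measurable_compose[OF this measurable_hidden_edge_update] show ?thesis by simp
qed

lemma integral_hidden_edge_kernel:
  assumes s: "0 < s" and \<theta>: "\<theta> \<in> space M" and f: "f \<in> borel_measurable M" "bounded (f ` space M)"
  shows "(\<integral>\<theta>'. f \<theta>' \<partial>hidden_edge_kernel M s i j \<theta>) - f \<theta> = hidden_edge_gen s i j f \<theta>"
proof -
  let ?B = "beta_distribution (2 * s) (2 * s)"
  let ?h = "\<lambda>u. \<theta>(i := \<theta> i * u + \<theta> j * (1 - u), j := \<theta> i * u + \<theta> j * (1 - u))"
  interpret prob_space ?B using s by (intro prob_space_beta_distribution) auto
  note h = measurable_hidden_edge_update_fixed[OF \<theta>, of i j "2 * s" "2 * s"]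
  obtain C where C: "\<And>\<theta>. \<theta> \<in> space M \<Longrightarrow> \<bar>f \<theta>\<bar> \<le> C" using f(2) by (auto simp: bounded_iff)
  have "integrable ?B (\<lambda>u. f (?h u))"
    using C measurable_space[OF h] by (intro integrable_const_bound[where B=C] measurable_compose[OF h f(1)]) auto
  then have "hidden_edge_gen s i j f \<theta> = (\<integral>u. f (?h u) \<partial>?B) - f \<theta>"
    by (simp add: hidden_edge_gen_def prob_space[simplified])
  then show ?thesis
    using h f(1) by (simp add: hidden_edge_kernel_def integral_distr)
qed

text \<open>Both kernels leave the coordinates off the edge alone, and these contribute the common
  factor \<open>R\<close>. On singletons the claim is then the two-variable identity of
  \<open>discrete_gamma_edge_intertwining\<close>.\<close>

lemma edge_kernel_intertwining:
  assumes s: "0 < s" and ij: "i \<noteq> j" and \<theta>: "\<theta> \<in> space M"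
  shows "discrete_gamma_product s \<theta> \<bind> kmp_edge_kernel s i j =
    hidden_edge_kernel M s i j \<theta> \<bind> discrete_gamma_product s"
proof (rule measure_eqI_countable[where A=UNIV])
  have \<nu>: "discrete_gamma_product s \<in> M \<rightarrow>\<^sub>M prob_algebra config_space"
    unfolding M by (rule measurable_discrete_gamma_product[OF s A(2)])
  let ?B = "beta_distribution (2 * s) (2 * s)"
  have nn: "0 \<le> \<theta> l" if "\<theta> \<in> space M" for \<theta> l
    using that A(2) by (auto simp: space_hidden)
  note \<nu>\<theta> = measurable_space[OF \<nu> \<theta>]
  note Q = measurable_kmp_edge_kernel[of s i j]
  note H = measurable_hidden_edge_kernel[OF s, of i j]
  show "sets (discrete_gamma_product s \<theta> \<bind> kmp_edge_kernel s i j) = Pow UNIV"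
    using sets_bind'[OF \<nu>\<theta> Q] by (simp add: config_space_eq)
  show "sets (hidden_edge_kernel M s i j \<theta> \<bind> discrete_gamma_product s) = Pow UNIV"
    using sets_bind'[OF measurable_space[OF H \<theta>] \<nu>] by (simp add: config_space_eq)
  fix \<eta> :: "'v \<Rightarrow> nat"
  let ?m = "\<lambda>\<theta> l k. discrete_gamma_mass s (\<theta> l) k"
  define n where "n = \<eta> i + \<eta> j"
  define h where "h a = \<eta>(i := a, j := n - a)" for a
  define R where "R = (\<Prod>l\<in>UNIV - {i} - {j}. ?m \<theta> l (\<eta> l))"
  have R: "0 \<le> R" unfolding R_def by (intro prod_nonneg ballI discrete_gamma_mass_nonneg s nn \<theta>)
  have split: "(\<Prod>l\<in>UNIV. g l) = g i * (g j * (\<Prod>l\<in>UNIV - {i} - {j}. g l))" for g :: "'v \<Rightarrow> real"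
  proof -
    have "prod g UNIV = g i * prod g (UNIV - {i})" by (rule prod.remove) auto
    also have "prod g (UNIV - {i}) = g j * prod g (UNIV - {i} - {j})" by (rule prod.remove) (use ij in auto)
    finally show ?thesis .
  qed
  have inj: "inj_on h {..n}" using ij by (auto simp: inj_on_def h_def fun_eq_iff split: if_splits)
  have "emeasure (discrete_gamma_product s \<theta> \<bind> kmp_edge_kernel s i j) {\<eta>} =
    (\<integral>\<^sup>+\<xi>. emeasure (kmp_edge_kernel s i j \<xi>) {\<eta>} \<partial>discrete_gamma_product s \<theta>)"
    by (rule emeasure_bind_prob_algebra[OF \<nu>\<theta> Q]) (simp add: config_space_eq)
  also have "\<dots> = (\<integral>\<^sup>+\<xi>. ennreal (beta_binomial s n (\<eta> i)) * indicator (h ` {..n}) \<xi> \<partial>discrete_gamma_product s \<theta>)"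
    by (intro nn_integral_cong) (simp add: emeasure_kmp_edge_kernel_singleton[OF s ij] n_def h_def indicator_def)
  also have "\<dots> = ennreal (beta_binomial s n (\<eta> i)) * emeasure (discrete_gamma_product s \<theta>) (h ` {..n})"
    by (rule nn_integral_cmult_indicator) (simp add: sets_discrete_gamma_product config_space_eq)
  also have "emeasure (discrete_gamma_product s \<theta>) (h ` {..n}) = (\<Sum>\<xi>\<in>h ` {..n}. emeasure (discrete_gamma_product s \<theta>) {\<xi>})"
    by (rule emeasure_eq_sum_singleton) (auto simp: sets_discrete_gamma_product config_space_eq)
  also have "\<dots> = (\<Sum>a\<le>n. ennreal (?m \<theta> i a * ?m \<theta> j (n - a) * R))"
  proof (subst sum.reindex[OF inj], rule sum.cong[OF refl])
    fix a
    have "(\<Prod>l\<in>UNIV. ?m \<theta> l (h a l)) = ?m \<theta> i a * ?m \<theta> j (n - a) * R"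
      unfolding split R_def using ij by (simp add: h_def)
    then show "((\<lambda>\<xi>. emeasure (discrete_gamma_product s \<theta>) {\<xi>}) \<circ> h) a = ennreal (?m \<theta> i a * ?m \<theta> j (n - a) * R)"
      by (simp add: emeasure_discrete_gamma_product_singleton[OF s nn[OF \<theta>]])
  qed
  also have "ennreal (beta_binomial s n (\<eta> i)) * \<dots> =
    ennreal ((\<Sum>a\<le>n. ?m \<theta> i a * ?m \<theta> j (n - a)) * beta_binomial s n (\<eta> i)) * ennreal R"
  proof -
    let ?S = "\<Sum>a\<le>n. ?m \<theta> i a * ?m \<theta> j (n - a)"
    have nn': "0 \<le> ?m \<theta> i a * ?m \<theta> j (n - a)" for a
      by (intro mult_nonneg_nonneg discrete_gamma_mass_nonneg s nn \<theta>)
    then have "0 \<le> ?S" by (intro sum_nonneg)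
    have "(\<Sum>a\<le>n. ennreal (?m \<theta> i a * ?m \<theta> j (n - a) * R)) = ennreal (?S * R)"
      unfolding sum_distrib_right by (intro sum_ennreal mult_nonneg_nonneg[OF nn' R])
    then have "ennreal (beta_binomial s n (\<eta> i)) * (\<Sum>a\<le>n. ennreal (?m \<theta> i a * ?m \<theta> j (n - a) * R)) =
        ennreal (beta_binomial s n (\<eta> i) * (?S * R))"
      using \<open>0 \<le> ?S\<close> R by (simp only: ennreal_mult''[symmetric] mult_nonneg_nonneg)
    also have "beta_binomial s n (\<eta> i) * (?S * R) = ?S * beta_binomial s n (\<eta> i) * R"
      by (simp only: mult_ac)
    finally show ?thesis
      using R by (simp only: ennreal_mult'')
  qed
  also have "\<dots> = (\<integral>\<^sup>+u. ennreal (discrete_gamma_mass s (\<theta> i * u + \<theta> j * (1 - u)) (\<eta> i) *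
      discrete_gamma_mass s (\<theta> i * u + \<theta> j * (1 - u)) (\<eta> j)) \<partial>?B) * ennreal R"
    unfolding n_def discrete_gamma_edge_intertwining[OF s nn[OF \<theta>] nn[OF \<theta>]] ..
  also have "\<dots> = (\<integral>\<^sup>+u. ennreal (discrete_gamma_mass s (\<theta> i * u + \<theta> j * (1 - u)) (\<eta> i) *
      discrete_gamma_mass s (\<theta> i * u + \<theta> j * (1 - u)) (\<eta> j)) * ennreal R \<partial>?B)"
  proof (rule nn_integral_multc[symmetric])
    show "(\<lambda>u. ennreal (discrete_gamma_mass s (\<theta> i * u + \<theta> j * (1 - u)) (\<eta> i) *
      discrete_gamma_mass s (\<theta> i * u + \<theta> j * (1 - u)) (\<eta> j))) \<in> borel_measurable ?B"
      unfolding measurable_cong_sets[OF sets_beta_distribution refl] discrete_gamma_mass_def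
      by (intro measurable_restrict_space1) measurable
  qed
  also have "\<dots> = (\<integral>\<^sup>+u. emeasure (discrete_gamma_product s
      (\<theta>(i := \<theta> i * u + \<theta> j * (1 - u), j := \<theta> i * u + \<theta> j * (1 - u)))) {\<eta>} \<partial>?B)"
  proof (rule nn_integral_cong)
    fix u assume "u \<in> space ?B"
    from measurable_space[OF measurable_hidden_edge_update_fixed[OF \<theta>] this, of i j]
    have \<theta>': "\<theta>(i := \<theta> i * u + \<theta> j * (1 - u), j := \<theta> i * u + \<theta> j * (1 - u)) \<in> space M"
      (is "?\<theta> \<in> _") .
    have "(\<Prod>l\<in>UNIV. ?m ?\<theta> l (\<eta> l)) = discrete_gamma_mass s (\<theta> i * u + \<theta> j * (1 - u)) (\<eta> i) *
      discrete_gamma_mass s (\<theta> i * u + \<theta> j * (1 - u)) (\<eta> j) * R"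
      unfolding split R_def using ij by simp
    then show "ennreal (discrete_gamma_mass s (\<theta> i * u + \<theta> j * (1 - u)) (\<eta> i) *
      discrete_gamma_mass s (\<theta> i * u + \<theta> j * (1 - u)) (\<eta> j)) * ennreal R =
      emeasure (discrete_gamma_product s ?\<theta>) {\<eta>}"
      unfolding emeasure_discrete_gamma_product_singleton[OF s nn[OF \<theta>']]
      using R by (simp add: ennreal_mult''[symmetric])
  qed
  also have "\<dots> = (\<integral>\<^sup>+\<theta>'. emeasure (discrete_gamma_product s \<theta>') {\<eta>} \<partial>hidden_edge_kernel M s i j \<theta>)"
    unfolding hidden_edge_kernel_def
    by (rule nn_integral_distr[OF measurable_hidden_edge_update_fixed[OF \<theta>], symmetric])
       (auto intro: measurable_compose[OF measurable_prob_algebraD[OF \<nu>] measurable_emeasure_subprob_algebra] simp: config_space_eq)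
  also have "\<dots> = emeasure (hidden_edge_kernel M s i j \<theta> \<bind> discrete_gamma_product s) {\<eta>}"
    by (rule emeasure_bind_prob_algebra[OF measurable_space[OF H \<theta>] \<nu>, symmetric]) (simp add: config_space_eq)
  finally show "emeasure (discrete_gamma_product s \<theta> \<bind> kmp_edge_kernel s i j) {\<eta>} =
    emeasure (hidden_edge_kernel M s i j \<theta> \<bind> discrete_gamma_product s) {\<eta>}" .
qed (rule countableI_type)

end

section \<open>Intertwining of the semigroups\<close>

definition kmp_kernel :: "('v::finite \<Rightarrow> 'v \<Rightarrow> real) \<Rightarrow> real \<Rightarrow> ('v \<Rightarrow> nat) \<Rightarrow> ('v \<Rightarrow> nat) measure" where
  "kmp_kernel p s = edge_mixture config_space p (kmp_edge_kernel s)"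

definition hidden_kernel ::
  "('v \<Rightarrow> real) measure \<Rightarrow> ('v::finite \<Rightarrow> 'v \<Rightarrow> real) \<Rightarrow> real \<Rightarrow> ('v \<Rightarrow> real) \<Rightarrow> ('v \<Rightarrow> real) measure" where
  "hidden_kernel M p s = edge_mixture M p (hidden_edge_kernel M s)"

lemma measurable_kmp_kernel: "kmp_kernel p s \<in> config_space \<rightarrow>\<^sub>M prob_algebra config_space"
  unfolding kmp_kernel_def by (intro measurable_edge_mixture measurable_kmp_edge_kernel)

lemma kmp_gen_eq:
  assumes "\<And>i j. 0 \<le> p i j" "0 < s" "f \<in> borel_measurable config_space" "bounded (f ` space config_space)"
  shows "kmp_gen p s f \<eta> = total_weight p * ((\<integral>\<xi>. f \<xi> \<partial>kmp_kernel p s \<eta>) - f \<eta>)"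
  unfolding kmp_kernel_def kmp_gen_def
  by (subst edge_mixture_generator[OF assms(1) measurable_kmp_edge_kernel assms(3,4)])
     (simp_all add: config_space_eq integral_kmp_edge_kernel[OF assms(2)])

section \<open>Interchange and associativity of mixtures of kernels\<close>

lemma measure_pmf_bind_commute:
  fixes q :: "'i::countable pmf"
  assumes \<mu>: "\<mu> \<in> space (prob_algebra M)" and k: "\<And>n. k n \<in> M \<rightarrow>\<^sub>M prob_algebra N"
  shows "\<mu> \<bind> (\<lambda>x. measure_pmf q \<bind> (\<lambda>n. k n x)) = measure_pmf q \<bind> (\<lambda>n. \<mu> \<bind> k n)"
proof -
  interpret A: prob_space \<mu> using \<mu> by (simp add: space_prob_algebra)
  interpret pair_prob_space \<mu> "measure_pmf q" ..
  have "sets \<mu> = sets M" using \<mu> by (simp add: space_prob_algebra)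
  then have k': "k n \<in> \<mu> \<rightarrow>\<^sub>M subprob_algebra N" for n
    using k[of n] measurable_prob_algebraD by (simp cong: measurable_cong_sets)
  have "(\<lambda>(x, n). k n x) \<in> \<mu> \<Otimes>\<^sub>M measure_pmf q \<rightarrow>\<^sub>M subprob_algebra N"
    unfolding split_beta
    by (rule measurable_compose_countable[where f="\<lambda>n p. k n (fst p)" and g=snd])
       (auto intro: measurable_compose[OF measurable_fst k'])
  from bind_rotate[OF this] show ?thesis .
qed

lemma bind_pmf_mixture_assoc:
  fixes q :: "'i::countable pmf"
  assumes "\<And>n. k n \<in> space (prob_algebra M)" "\<nu> \<in> M \<rightarrow>\<^sub>M prob_algebra N"
  shows "(measure_pmf q \<bind> k) \<bind> \<nu> = measure_pmf q \<bind> (\<lambda>n. k n \<bind> \<nu>)"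
proof (rule bind_assoc[OF _ measurable_prob_algebraD[OF assms(2)]])
  have "k \<in> count_space UNIV \<rightarrow>\<^sub>M prob_algebra M" using assms(1) by simp
  from measurable_prob_algebraD[OF this] show "k \<in> measure_pmf q \<rightarrow>\<^sub>M subprob_algebra M"
    by (simp cong: measurable_cong_sets)
qed

lemma bind_kernel_assoc:
  assumes \<mu>: "\<mu> \<in> space (prob_algebra M)" and k: "k \<in> M \<rightarrow>\<^sub>M prob_algebra N" and l: "l \<in> N \<rightarrow>\<^sub>M prob_algebra R"
  shows "(\<mu> \<bind> k) \<bind> l = \<mu> \<bind> (\<lambda>x. k x \<bind> l)"
proof (rule bind_assoc[OF _ measurable_prob_algebraD[OF l]])
  have "sets \<mu> = sets M" using \<mu> by (simp add: space_prob_algebra)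
  then show "k \<in> \<mu> \<rightarrow>\<^sub>M subprob_algebra N"
    using measurable_prob_algebraD[OF k] by (simp cong: measurable_cong_sets)
qed

text \<open>Intertwining is linear in the pair of kernels, so it passes to mixtures; both models
  must pick the edge with the same law \<open>edge_pmf p\<close>.\<close>

lemma edge_mixture_intertwining:
  assumes \<nu>: "\<nu> \<in> M \<rightarrow>\<^sub>M prob_algebra N"
    and k: "\<And>i j. k i j \<in> M \<rightarrow>\<^sub>M prob_algebra M" and l: "\<And>i j. l i j \<in> N \<rightarrow>\<^sub>M prob_algebra N"
    and intertwining: "\<And>i j. i \<noteq> j \<Longrightarrow> \<nu> x \<bind> l i j = k i j x \<bind> \<nu>"
    and x: "x \<in> space M"
  shows "\<nu> x \<bind> edge_mixture N p l = edge_mixture M p k x \<bind> \<nu>"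
proof -
  have 1: "\<nu> x \<bind> edge_kernel N l e = edge_kernel M k e x \<bind> \<nu>" for e
  proof (cases e)
    case (Pair i j)
    have "\<nu> x \<bind> return N = return M x \<bind> \<nu>"
      using kernel_space[OF \<nu> x] x by (simp add: bind_return'' bind_return[OF measurable_prob_algebraD[OF \<nu>]])
    then show ?thesis using intertwining Pair by (simp add: edge_kernel_def)
  qed
  have "\<nu> x \<bind> edge_mixture N p l = measure_pmf (edge_pmf p) \<bind> (\<lambda>e. \<nu> x \<bind> edge_kernel N l e)"
    unfolding edge_mixture_def [abs_def]
    by (rule measure_pmf_bind_commute[OF measurable_space[OF \<nu> x] measurable_edge_kernel[OF l]])
  also have "\<dots> = edge_mixture M p k x \<bind> \<nu>"
    unfolding 1 edge_mixture_def
    by (rule bind_pmf_mixture_assoc[OF measurable_space[OF measurable_edge_kernel[OF k] x] \<nu>, symmetric])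
  finally show ?thesis .
qed

text \<open>The number of jumps up to time t has the same Poisson law in both models, so it suffices
  to intertwine after n jumps, by induction on n. The starting point stays arbitrary in the
  induction because after the first jump it is the random point \<open>y\<close>.\<close>

lemma uniformized_intertwining:
  assumes \<nu>: "\<nu> \<in> M \<rightarrow>\<^sub>M prob_algebra N"
    and P: "P \<in> M \<rightarrow>\<^sub>M prob_algebra M" and Q: "Q \<in> N \<rightarrow>\<^sub>M prob_algebra N"
    and intertwining: "\<And>x. x \<in> space M \<Longrightarrow> \<nu> x \<bind> Q = P x \<bind> \<nu>"
    and x: "x \<in> space M"
  shows "\<nu> x \<bind> uniformized N c Q t = uniformized M c P t x \<bind> \<nu>"
proof -
  note Pn = measurable_kernel_power[OF P] and Qn = measurable_kernel_power[OF Q]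
  have 1: "\<nu> x \<bind> kernel_power N Q n = kernel_power M P n x \<bind> \<nu>" if "x \<in> space M" for n x
    using that
  proof (induction n arbitrary: x)
    case 0
    then show ?case
      using kernel_space[OF \<nu> 0] by (simp add: bind_return'' bind_return[OF measurable_prob_algebraD[OF \<nu>]])
  next
    case (Suc n)
    note \<nu>x = measurable_space[OF \<nu> Suc.prems] and Px = measurable_space[OF P Suc.prems]
    have "\<nu> x \<bind> kernel_power N Q (Suc n) = (\<nu> x \<bind> Q) \<bind> kernel_power N Q n"
      by (simp add: bind_kernel_assoc[OF \<nu>x Q Qn])
    also have "\<dots> = P x \<bind> (\<lambda>y. \<nu> y \<bind> kernel_power N Q n)"
      by (simp add: intertwining[OF Suc.prems] bind_kernel_assoc[OF Px \<nu> Qn])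
    also have "\<dots> = P x \<bind> (\<lambda>y. kernel_power M P n y \<bind> \<nu>)"
      using Suc.IH kernel_space[OF P Suc.prems] by (intro bind_cong) auto
    also have "\<dots> = kernel_power M P (Suc n) x \<bind> \<nu>"
      by (simp add: bind_kernel_assoc[OF Px Pn \<nu>])
    finally show ?case .
  qed
  let ?q = "poisson_pmf (c * t)"
  have "\<nu> x \<bind> uniformized N c Q t = measure_pmf ?q \<bind> (\<lambda>n. \<nu> x \<bind> kernel_power N Q n)"
    unfolding uniformized_def [abs_def]
    by (rule measure_pmf_bind_commute[OF measurable_space[OF \<nu> x] Qn])
  also have "\<dots> = uniformized M c P t x \<bind> \<nu>"
    unfolding 1[OF x] uniformized_def
    by (rule bind_pmf_mixture_assoc[OF measurable_space[OF Pn x] \<nu>, symmetric])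
  finally show ?thesis .
qed

section \<open>Evolution of products and of their mixtures\<close>

context
  fixes A :: "real set" and M :: "('v::finite \<Rightarrow> real) measure"
    and p :: "'v \<Rightarrow> 'v \<Rightarrow> real" and s :: real
  assumes A: "convex A" "A \<subseteq> {0..}" and M: "M = PiM UNIV (\<lambda>_. restrict_space borel A)"
    and p: "\<And>i j. 0 \<le> p i j" and s: "0 < s"
begin

lemma measurable_hidden_kernel: "hidden_kernel M p s \<in> M \<rightarrow>\<^sub>M prob_algebra M"
  unfolding hidden_kernel_def
  by (intro measurable_edge_mixture measurable_hidden_edge_kernel[OF A M s])

lemma hidden_gen_eq:
  assumes "f \<in> borel_measurable M" "bounded (f ` space M)" "\<theta> \<in> space M"
  shows "hidden_gen p s f \<theta> = total_weight p * ((\<integral>\<theta>'. f \<theta>' \<partial>hidden_kernel M p s \<theta>) - f \<theta>)"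
  unfolding hidden_kernel_def hidden_gen_def
  by (subst edge_mixture_generator[OF p measurable_hidden_edge_kernel[OF A M s] assms])
     (simp add: integral_hidden_edge_kernel[OF A M s assms(3,1,2)])

lemma discrete_gamma_product_evolve:
  assumes S: "markov_semigroup config_space (kmp_gen p s) S" and t: "0 < t" and \<theta>: "\<theta> \<in> space M"
  shows "discrete_gamma_product s \<theta> \<bind> S t =
    uniformized M (total_weight p) (hidden_kernel M p s) t \<theta> \<bind> discrete_gamma_product s"
proof -
  have \<nu>: "discrete_gamma_product s \<in> M \<rightarrow>\<^sub>M prob_algebra config_space"
    unfolding M by (rule measurable_discrete_gamma_product[OF s A(2)])
  have "S t \<eta> = uniformized config_space (total_weight p) (kmp_kernel p s) t \<eta>" for \<eta>
    by (rule semigroup_uniformization[OF S measurable_kmp_kernel total_weight_pos[OF p] kmp_gen_eq[OF p s] t])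
       (simp_all add: config_space_eq)
  then have "discrete_gamma_product s \<theta> \<bind> S t =
    discrete_gamma_product s \<theta> \<bind> uniformized config_space (total_weight p) (kmp_kernel p s) t"
    by (metis ext)
  also have "\<dots> = uniformized M (total_weight p) (hidden_kernel M p s) t \<theta> \<bind> discrete_gamma_product s"
  proof (rule uniformized_intertwining[OF \<nu> measurable_hidden_kernel measurable_kmp_kernel _ \<theta>])
    show "discrete_gamma_product s \<theta> \<bind> kmp_kernel p s = hidden_kernel M p s \<theta> \<bind> discrete_gamma_product s"
      if "\<theta> \<in> space M" for \<theta>
      unfolding kmp_kernel_def hidden_kernel_def
      by (rule edge_mixture_intertwining[OF \<nu> measurable_hidden_edge_kernel[OF A M s] measurable_kmp_edge_kernel
            edge_kernel_intertwining[OF A M s _ that] that])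
  qed
  finally show ?thesis .
qed

lemma discrete_gamma_mixture_evolve:
  assumes S: "markov_semigroup config_space (kmp_gen p s) S" and t: "0 \<le> t" and \<Xi>: "\<Xi> \<in> space (prob_algebra M)"
  shows "\<exists>\<Xi>'\<in>space (prob_algebra M). (\<Xi> \<bind> discrete_gamma_product s) \<bind> S t = \<Xi>' \<bind> discrete_gamma_product s"
proof -
  have \<nu>: "discrete_gamma_product s \<in> M \<rightarrow>\<^sub>M prob_algebra config_space"
    unfolding M by (rule measurable_discrete_gamma_product[OF s A(2)])
  have St: "S t \<in> config_space \<rightarrow>\<^sub>M prob_algebra config_space"
    using S t by (simp add: markov_semigroup_def)
  have sets: "sets \<Xi> = sets M" using \<Xi> by (simp add: space_prob_algebra)
  show ?thesis
  proof (cases "t = 0")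
    \<comment> \<open>The Poisson form of the semigroup is available for positive times only; at
      time 0 the mixing measure itself is the witness.\<close>
    case True
    have "S 0 = return config_space"
      using S by (simp add: markov_semigroup_def config_space_eq fun_eq_iff)
    then have "(\<Xi> \<bind> discrete_gamma_product s) \<bind> S t = \<Xi> \<bind> discrete_gamma_product s"
      using sets_bind'[OF \<Xi> \<nu>] by (simp add: True bind_return'')
    then show ?thesis using \<Xi> by blast
  next
    case False
    with t have t: "0 < t" by simp
    \<comment> \<open>\<open>\<Xi> \<bind> ?R\<close> is the law at time t of the hidden chain
      started from \<Xi>. As \<open>?R\<close> is a probability kernel on \<open>M\<close>, this is
      again a mixing measure on the same parameter set.\<close>
    let ?R = "uniformized M (total_weight p) (hidden_kernel M p s) t"
    have R: "?R \<in> M \<rightarrow>\<^sub>M prob_algebra M"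
      by (rule measurable_uniformized[OF measurable_hidden_kernel])
    have "(\<Xi> \<bind> discrete_gamma_product s) \<bind> S t = \<Xi> \<bind> (\<lambda>\<theta>. discrete_gamma_product s \<theta> \<bind> S t)"
      by (rule bind_kernel_assoc[OF \<Xi> \<nu> St])
    also have "\<dots> = \<Xi> \<bind> (\<lambda>\<theta>. ?R \<theta> \<bind> discrete_gamma_product s)"
      by (intro bind_cong refl discrete_gamma_product_evolve[OF S t])
         (simp add: sets_eq_imp_space_eq[OF sets])
    also have "\<dots> = (\<Xi> \<bind> ?R) \<bind> discrete_gamma_product s"
      by (rule bind_kernel_assoc[OF \<Xi> R \<nu>, symmetric])
    finally have "(\<Xi> \<bind> discrete_gamma_product s) \<bind> S t = (\<Xi> \<bind> ?R) \<bind> discrete_gamma_product s" .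
    moreover have "\<Xi> \<bind> ?R \<in> space (prob_algebra M)"
      using prob_space_bind'[OF \<Xi> R] sets_bind'[OF \<Xi> R] by (simp add: space_prob_algebra)
    ultimately show ?thesis by blast
  qed
qed

end

theorem theorem2p1:
  fixes p :: "'v::finite \<Rightarrow> 'v \<Rightarrow> real"
    and s :: real
    and S :: "real \<Rightarrow> ('v \<Rightarrow> nat) \<Rightarrow> ('v \<Rightarrow> nat) measure"
  assumes p_nonneg: "\<And>i j. 0 \<le> p i j"
    and p_sym: "\<And>i j. p i j = p j i"
    and p_irreducible: "irreducible_weights p"
    and s_pos: "0 < s"
    and S: "markov_semigroup config_space (kmp_gen p s) S"
  shows "(\<forall>\<theta> (\<Omega> :: 'w measure) X t.
            (\<forall>i. 0 < \<theta> i) \<and>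
            markov_process_with_generator hidden_space (hidden_gen p s) \<Omega> X \<and>
            (AE \<omega> in \<Omega>. X 0 \<omega> = \<theta>) \<and>
            0 < t \<longrightarrow>
            evolve (discrete_gamma_product s \<theta>) S t
              = \<Omega> \<bind> (\<lambda>\<omega>. discrete_gamma_product s (X t \<omega>))) \<and>
         (\<forall>t\<ge>0. \<forall>\<mu>\<in>discrete_gamma_mixtures s. evolve \<mu> S t \<in> discrete_gamma_mixtures s)"
proof (intro conjI allI impI ballI)
  fix \<theta> and \<Omega> :: "'w measure" and X and t :: real
  assume H: "(\<forall>i. 0 < \<theta> i) \<and> markov_process_with_generator hidden_space (hidden_gen p s) \<Omega> X \<and>
    (AE \<omega> in \<Omega>. X 0 \<omega> = \<theta>) \<and> 0 < t"
  then obtain K where K: "markov_semigroup hidden_space (hidden_gen p s) K" and X: "markov_process hidden_space K \<Omega> X"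
    by (auto simp: markov_process_with_generator_def)
  from H have X0: "AE \<omega> in \<Omega>. X 0 \<omega> = \<theta>" and t: "0 < t" by simp_all
  note t = t less_imp_le[OF t]
  interpret prob_space \<Omega> using X by (simp add: markov_process_def)
  let ?M = "hidden_space :: ('v \<Rightarrow> real) measure" and ?\<nu> = "discrete_gamma_product s"
  have A: "convex {0::real..}" "{0::real..} \<subseteq> {0..}" by auto
  note M = hidden_space_def
  have \<nu>: "?\<nu> \<in> ?M \<rightarrow>\<^sub>M prob_algebra config_space"
    unfolding M by (rule measurable_discrete_gamma_product[OF s_pos A(2)])
  have \<theta>: "\<theta> \<in> space ?M" using H by (simp add: space_hidden[OF A M] less_imp_le)
  have Xm: "X t \<in> \<Omega> \<rightarrow>\<^sub>M ?M" "X 0 \<in> \<Omega> \<rightarrow>\<^sub>M ?M" using X t by (auto simp: markov_process_def)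
  \<comment> \<open>The start in \<theta> is assumed almost surely only, which is enough for the
    initial law to be the point mass at \<theta>.\<close>
  have "distr \<Omega> ?M (X 0) = distr \<Omega> ?M (\<lambda>_. \<theta>)"
    using X0 Xm \<theta> by (intro distr_cong_AE) auto
  then have "distr \<Omega> ?M (X 0) = return ?M \<theta>"
    using \<theta> by simp
  then have "distr \<Omega> ?M (X t) = K t \<theta>"
    using distr_markov_process[OF K X t(2)] \<theta> measurable_prob_algebraD[OF semigroup_kernel[OF K t(2)]]
    by (simp add: evolve_def bind_return)
  \<comment> \<open>\<open>K\<close> is known only to exist. Uniqueness identifies it with the
    explicit kernel that appears in the evolution of the product measure.\<close>
  also have "\<dots> = uniformized ?M (total_weight p) (hidden_kernel ?M p s) t \<theta>"
    by (rule semigroup_uniformization[OF K measurable_hidden_kernel[OF A M p_nonneg s_pos] total_weight_pos[OF p_nonneg]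
          hidden_gen_eq[OF A M p_nonneg s_pos] t(1) \<theta>])
  finally have "evolve (?\<nu> \<theta>) S t = distr \<Omega> ?M (X t) \<bind> ?\<nu>"
    unfolding evolve_def discrete_gamma_product_evolve[OF A M p_nonneg s_pos S t(1) \<theta>] by simp
  also have "\<dots> = \<Omega> \<bind> (\<lambda>\<omega>. ?\<nu> (X t \<omega>))"
    by (rule bind_distr[OF Xm(1) measurable_prob_algebraD[OF \<nu>] not_empty])
  finally show "evolve (?\<nu> \<theta>) S t = \<Omega> \<bind> (\<lambda>\<omega>. ?\<nu> (X t \<omega>))" .
next
  fix t :: real and \<mu> :: "('v \<Rightarrow> nat) measure"
  assume t: "0 \<le> t" and "\<mu> \<in> discrete_gamma_mixtures s"
  then obtain \<Xi> where \<Xi>: "\<Xi> \<in> space (prob_algebra parameter_space)" "\<mu> = \<Xi> \<bind> discrete_gamma_product s"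
    by (auto simp: discrete_gamma_mixtures_def)
  \<comment> \<open>The open half-line, unlike in the first claim: mixing measures have to stay on
    strictly positive parameters.\<close>
  have "convex {0::real<..}" "{0::real<..} \<subseteq> {0..}" by auto
  from discrete_gamma_mixture_evolve[OF this parameter_space_def p_nonneg s_pos S t \<Xi>(1)]
  show "evolve \<mu> S t \<in> discrete_gamma_mixtures s"
    unfolding evolve_def \<Xi>(2) discrete_gamma_mixtures_def by blast
qed

end
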